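(* Let $\mathscr{R}$ be a finite von Neumann algebra with a faithful normal tracial state $\tau$, let $\mathscr{S}$ be a von Neumann subalgebra of $\mathscr{R}$, and let $\Phi:\mathscr{R}\to\mathscr{S}$ be a $\tau$-preserving conditional expectation from $\mathscr{R}$ onto $\mathscr{S}$. Let $\Delta$ denote the Fuglede-Kadison determinant on $\mathscr{R}$ associated with $\tau$. For a regular positive operator $A$ in $\mathscr{R}$ and a positive operator $B$ in $\mathscr{S}$, $$\frac{\Delta(A+B)}{\Delta(A)}\le\frac{\Delta(\Phi(A^{-1})^{-1}+B)}{\Delta(\Phi(A^{-1})^{-1})},$$ with equality if and only if $B^{1/2}A^{-1}B^{1/2}\in\mathscr{S}$. In particular, if $B$ is regular, equality holds if and only if $A\in\mathscr{S}$.
   Context: Von Neumann algebras act on a separable complex Hilbert space and contain the identity operator $I$; $\mathscr{S}$ contains the identity $I$ of $\mathscr{R}$. "Regular" means invertible (with bounded inverse). Conditional expectation: a map $\Phi:\mathscr{R}\to\mathscr{S}$ that is linear, positive, with $\Phi(I)=I$, and $\Phi(S_1RS_2)=S_1\Phi(R)S_2$ for all $R\in\mathscr{R}$, $S_1,S_2\in\mathscr{S}$. It is $\tau$-preserving if $\tau(\Phi(R))=\tau(R)$ for all $R\in\mathscr{R}$. Fuglede-Kadison determinant: for regular $A\in\mathscr{R}$, $\Delta(A)=\exp(\tau(\log (A^*A)^{1/2}))$ (all operators to which $\Delta$ is applied in the claim are regular). *)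

theory Defs
  imports "HOL-Analysis.Analysis" "HOL-Computational_Algebra.Polynomial"
begin

section \<open>Complex Hilbert spaces\<close>

class complex_hilbert = banach +
  fixes scaleC :: "complex \<Rightarrow> 'a \<Rightarrow> 'a"  (infixr \<open>*\<^sub>C\<close> 75)
    and cinner :: "'a \<Rightarrow> 'a \<Rightarrow> complex"
  assumes scaleC_add_right: "a *\<^sub>C (x + y) = a *\<^sub>C x + a *\<^sub>C y"
    and scaleC_add_left: "(a + b) *\<^sub>C x = a *\<^sub>C x + b *\<^sub>C x"
    and scaleC_scaleC: "a *\<^sub>C (b *\<^sub>C x) = (a * b) *\<^sub>C x"
    and scaleR_scaleC: "r *\<^sub>R x = complex_of_real r *\<^sub>C x"
    and cinner_commute: "cinner x y = cnj (cinner y x)"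
    and cinner_add_left: "cinner (x + y) z = cinner x z + cinner y z"
    and cinner_scaleC_left: "cinner (a *\<^sub>C x) y = a * cinner x y"
    and cinner_nonneg: "cinner x x \<in> \<real>\<^sub>\<ge>\<^sub>0"
    and norm_eq_sqrt_cinner: "norm x = sqrt (Re (cinner x x))"

lemma norm_scaleC: "norm (a *\<^sub>C x) = cmod a * norm (x :: 'h::complex_hilbert)"
proof -
  have "cinner (a *\<^sub>C x) (a *\<^sub>C x) = a * cnj a * cinner x x"
    by (metis cinner_commute cinner_scaleC_left complex_cnj_mult mult.assoc)
  also have "\<dots> = complex_of_real ((cmod a)\<^sup>2) * cinner x x"
    by (simp only: complex_norm_square)
  finally have "Re (cinner (a *\<^sub>C x) (a *\<^sub>C x)) = (cmod a)\<^sup>2 * Re (cinner x x)"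
    by simp
  then show ?thesis
    by (simp add: norm_eq_sqrt_cinner real_sqrt_mult)
qed

lemma bounded_linear_scaleC: "bounded_linear (\<lambda>x :: 'h::complex_hilbert. a *\<^sub>C x)"
  by (rule bounded_linear_intro[where K = "cmod a"])
    (simp_all add: scaleC_add_right scaleR_scaleC scaleC_scaleC norm_scaleC mult.commute)

section \<open>Bounded operators\<close>

text \<open>The library type \<open>'h \<Rightarrow>\<^sub>L 'h\<close> consists of the bounded \<^emph>\<open>real\<close>-linear operators;
  the bounded operators on the complex Hilbert space are those in \<open>bounded_ops\<close>.\<close>

definition bounded_ops :: "('h::complex_hilbert \<Rightarrow>\<^sub>L 'h) set" where
  "bounded_ops = {T. \<forall>c x. blinfun_apply T (c *\<^sub>C x) = c *\<^sub>C blinfun_apply T x}"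

definition scale_op :: "complex \<Rightarrow> ('h::complex_hilbert \<Rightarrow>\<^sub>L 'h) \<Rightarrow> ('h \<Rightarrow>\<^sub>L 'h)" where
  "scale_op c T = Blinfun (\<lambda>x. c *\<^sub>C blinfun_apply T x)"

lemma scale_op_apply: "blinfun_apply (scale_op c T) x = c *\<^sub>C blinfun_apply T x"
  unfolding scale_op_def
  by (simp add: bounded_linear_Blinfun_apply
      bounded_linear_compose[OF bounded_linear_scaleC blinfun.bounded_linear_right])

definition adj :: "('h::complex_hilbert \<Rightarrow>\<^sub>L 'h) \<Rightarrow> ('h \<Rightarrow>\<^sub>L 'h)" where
  "adj T = (THE S. \<forall>x y. cinner (blinfun_apply T x) y = cinner x (blinfun_apply S y))"

definition self_adjoint :: "('h::complex_hilbert \<Rightarrow>\<^sub>L 'h) \<Rightarrow> bool" where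
  "self_adjoint T \<longleftrightarrow> T \<in> bounded_ops \<and> adj T = T"

definition positive_op :: "('h::complex_hilbert \<Rightarrow>\<^sub>L 'h) \<Rightarrow> bool" where
  "positive_op T \<longleftrightarrow> T \<in> bounded_ops \<and> (\<forall>x. cinner (blinfun_apply T x) x \<in> \<real>\<^sub>\<ge>\<^sub>0)"

definition op_le :: "('h::complex_hilbert \<Rightarrow>\<^sub>L 'h) \<Rightarrow> ('h \<Rightarrow>\<^sub>L 'h) \<Rightarrow> bool" where
  "op_le T S \<longleftrightarrow> positive_op (S - T)"

text \<open>The inverse of a complex-linear operator is automatically complex-linear.\<close>

definition regular :: "('h::complex_hilbert \<Rightarrow>\<^sub>L 'h) \<Rightarrow> bool" where
  "regular T \<longleftrightarrow> (\<exists>S. T o\<^sub>L S = id_blinfun \<and> S o\<^sub>L T = id_blinfun)"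

definition op_inv :: "('h::complex_hilbert \<Rightarrow>\<^sub>L 'h) \<Rightarrow> ('h \<Rightarrow>\<^sub>L 'h)" where
  "op_inv T = (THE S. T o\<^sub>L S = id_blinfun \<and> S o\<^sub>L T = id_blinfun)"

section \<open>Continuous functional calculus\<close>

definition spectrum :: "('h::complex_hilbert \<Rightarrow>\<^sub>L 'h) \<Rightarrow> complex set" where
  "spectrum T = {z. \<not> regular (T - scale_op z id_blinfun)}"

definition poly_op :: "real poly \<Rightarrow> ('h::complex_hilbert \<Rightarrow>\<^sub>L 'h) \<Rightarrow> ('h \<Rightarrow>\<^sub>L 'h)" where
  "poly_op p T = (\<Sum>i\<le>degree p. coeff p i *\<^sub>R ((o\<^sub>L) T ^^ i) id_blinfun)"

text \<open>For self-adjoint \<open>T\<close> and \<open>f\<close> continuous on the (real) spectrum of \<open>T\<close>, the operator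
  \<open>f(T)\<close> is the norm limit of \<open>p\<^sub>n(T)\<close> for polynomials \<open>p\<^sub>n\<close> converging to \<open>f\<close> uniformly on
  the spectrum. In any other case the value is arbitrary.\<close>

definition cfc :: "(real \<Rightarrow> real) \<Rightarrow> ('h::complex_hilbert \<Rightarrow>\<^sub>L 'h) \<Rightarrow> ('h \<Rightarrow>\<^sub>L 'h)" where
  "cfc f T = (THE S. \<forall>p :: nat \<Rightarrow> real poly.
      uniform_limit {t. complex_of_real t \<in> spectrum T} (\<lambda>n. poly (p n)) f sequentially
        \<longrightarrow> (\<lambda>n. poly_op (p n) T) \<longlonglongrightarrow> S)"

definition op_sqrt :: "('h::complex_hilbert \<Rightarrow>\<^sub>L 'h) \<Rightarrow> ('h \<Rightarrow>\<^sub>L 'h)" where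
  "op_sqrt T = cfc sqrt T"

definition op_log :: "('h::complex_hilbert \<Rightarrow>\<^sub>L 'h) \<Rightarrow> ('h \<Rightarrow>\<^sub>L 'h)" where
  "op_log T = cfc ln T"

section \<open>Von Neumann algebras\<close>

definition von_neumann_algebra :: "('h::complex_hilbert \<Rightarrow>\<^sub>L 'h) set \<Rightarrow> bool" where
  "von_neumann_algebra R \<longleftrightarrow>
     R \<subseteq> bounded_ops \<and>
     id_blinfun \<in> R \<and>
     (\<forall>T\<in>R. \<forall>S\<in>R. T + S \<in> R) \<and>
     (\<forall>c. \<forall>T\<in>R. scale_op c T \<in> R) \<and>
     (\<forall>T\<in>R. \<forall>S\<in>R. T o\<^sub>L S \<in> R) \<and>
     (\<forall>T\<in>R. adj T \<in> R) \<and>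
     closedin strong_operator_topology R"

text \<open>Finiteness: the identity is not Murray--von Neumann equivalent to a proper subprojection,
  that is, every isometry in the algebra is unitary.\<close>

definition finite_von_neumann_algebra :: "('h::complex_hilbert \<Rightarrow>\<^sub>L 'h) set \<Rightarrow> bool" where
  "finite_von_neumann_algebra R \<longleftrightarrow> von_neumann_algebra R \<and>
     (\<forall>V\<in>R. adj V o\<^sub>L V = id_blinfun \<longrightarrow> V o\<^sub>L adj V = id_blinfun)"

definition tracial_state :: "('h::complex_hilbert \<Rightarrow>\<^sub>L 'h) set \<Rightarrow> (('h \<Rightarrow>\<^sub>L 'h) \<Rightarrow> complex) \<Rightarrow> bool" where
  "tracial_state R \<tau> \<longleftrightarrow>
     (\<forall>T\<in>R. \<forall>S\<in>R. \<tau> (T + S) = \<tau> T + \<tau> S) \<and>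
     (\<forall>c. \<forall>T\<in>R. \<tau> (scale_op c T) = c * \<tau> T) \<and>
     (\<forall>T\<in>R. positive_op T \<longrightarrow> \<tau> T \<in> \<real>\<^sub>\<ge>\<^sub>0) \<and>
     \<tau> id_blinfun = 1 \<and>
     (\<forall>T\<in>R. \<forall>S\<in>R. \<tau> (T o\<^sub>L S) = \<tau> (S o\<^sub>L T))"

definition faithful_on :: "('h::complex_hilbert \<Rightarrow>\<^sub>L 'h) set \<Rightarrow> (('h \<Rightarrow>\<^sub>L 'h) \<Rightarrow> complex) \<Rightarrow> bool" where
  "faithful_on R \<tau> \<longleftrightarrow> (\<forall>T\<in>R. positive_op T \<and> \<tau> T = 0 \<longrightarrow> T = 0)"

text \<open>Normality: \<open>\<tau>\<close> preserves the least upper bounds of increasing nets of self-adjoint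
  operators. Only the range of such a net matters, and this is an upward directed set \<open>D\<close>.\<close>

definition normal_on :: "('h::complex_hilbert \<Rightarrow>\<^sub>L 'h) set \<Rightarrow> (('h \<Rightarrow>\<^sub>L 'h) \<Rightarrow> complex) \<Rightarrow> bool" where
  "normal_on R \<tau> \<longleftrightarrow>
     (\<forall>D S. D \<noteq> {} \<and> D \<subseteq> {T\<in>R. self_adjoint T} \<and>
        (\<forall>T1\<in>D. \<forall>T2\<in>D. \<exists>T3\<in>D. op_le T1 T3 \<and> op_le T2 T3) \<and>
        S \<in> R \<and> self_adjoint S \<and> (\<forall>T\<in>D. op_le T S) \<and>
        (\<forall>U\<in>R. self_adjoint U \<and> (\<forall>T\<in>D. op_le T U) \<longrightarrow> op_le S U)
        \<longrightarrow> Re (\<tau> S) = (SUP T\<in>D. Re (\<tau> T)))"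

definition conditional_expectation ::
    "('h::complex_hilbert \<Rightarrow>\<^sub>L 'h) set \<Rightarrow> ('h \<Rightarrow>\<^sub>L 'h) set \<Rightarrow> (('h \<Rightarrow>\<^sub>L 'h) \<Rightarrow> ('h \<Rightarrow>\<^sub>L 'h)) \<Rightarrow> bool" where
  "conditional_expectation R S \<Phi> \<longleftrightarrow>
     \<Phi> \<in> R \<rightarrow> S \<and>
     (\<forall>T1\<in>R. \<forall>T2\<in>R. \<Phi> (T1 + T2) = \<Phi> T1 + \<Phi> T2) \<and>
     (\<forall>c. \<forall>T\<in>R. \<Phi> (scale_op c T) = scale_op c (\<Phi> T)) \<and>
     (\<forall>T\<in>R. positive_op T \<longrightarrow> positive_op (\<Phi> T)) \<and>
     \<Phi> id_blinfun = id_blinfun \<and>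
     (\<forall>T\<in>R. \<forall>S1\<in>S. \<forall>S2\<in>S. \<Phi> (S1 o\<^sub>L T o\<^sub>L S2) = S1 o\<^sub>L \<Phi> T o\<^sub>L S2)"

definition trace_preserving ::
    "('h::complex_hilbert \<Rightarrow>\<^sub>L 'h) set \<Rightarrow> (('h \<Rightarrow>\<^sub>L 'h) \<Rightarrow> complex) \<Rightarrow> (('h \<Rightarrow>\<^sub>L 'h) \<Rightarrow> ('h \<Rightarrow>\<^sub>L 'h)) \<Rightarrow> bool" where
  "trace_preserving R \<tau> \<Phi> \<longleftrightarrow> (\<forall>T\<in>R. \<tau> (\<Phi> T) = \<tau> T)"

text \<open>The Fuglede--Kadison determinant of a regular operator; the trace of the self-adjoint
  operator inside is real, and \<open>Re\<close> only converts it to the type of real numbers.\<close>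

definition fk_det :: "(('h::complex_hilbert \<Rightarrow>\<^sub>L 'h) \<Rightarrow> complex) \<Rightarrow> ('h \<Rightarrow>\<^sub>L 'h) \<Rightarrow> real" where
  "fk_det \<tau> T = exp (Re (\<tau> (op_log (op_sqrt (adj T o\<^sub>L T)))))"

end

theory Submission
  imports Defs "HOL-Computational_Algebra.Fundamental_Theorem_Algebra"
begin

text \<open>Put \<open>C = B\<^sup>1\<^sup>/\<^sup>2\<close> and \<open>X = C A\<inverse> C\<close>. Traciality gives
  \<open>d/dt \<tau>(log (A + tB)) = \<tau>((A + tB)\<inverse> B) = \<tau>((I + tX)\<inverse> X) = (1 - \<tau>((I + tX)\<inverse>)) / t\<close>.
  Replacing \<open>A\<close> by \<open>\<Phi>(A\<inverse>)\<inverse>\<close> replaces \<open>X\<close> by \<open>\<Phi>(X)\<close>, so it remains to compare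
  \<open>\<tau>(P\<inverse>)\<close> with \<open>\<tau>(Q\<inverse>)\<close> for \<open>P = I + tX\<close> and \<open>Q = \<Phi>(P)\<close>. Since
  \<open>\<tau>(Q\<inverse> P Q\<inverse>) = \<tau>(Q\<inverse>)\<close>, we have
  \<open>\<tau>(P\<inverse>) - \<tau>(Q\<inverse>) = \<tau>((P\<inverse> - Q\<inverse>) P (P\<inverse> - Q\<inverse>)) \<ge> 0\<close>, and by faithfulness the two
  sides agree only if \<open>P = Q\<close>, that is, \<open>X = \<Phi>(X)\<close>. The equality statement then follows from the
  mean value theorem on \<open>[0, 1]\<close>.\<close>

section \<open>Hermitian and positive operators\<close>

text \<open>Two obstacles shape the development. First, the functional calculus is nothing but a
  norm limit of polynomials in the operator, so all analysis rests on one estimate: for hermitian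
  \<open>T\<close>, the norm of \<open>p(T)\<close> is at most the supremum of
  \<open>\<bar>p\<bar>\<close> on the real spectrum. It is proved algebraically, by factoring real
  polynomials and testing invertibility. Second, \<open>A\<close> and \<open>B\<close> need not
  commute, so the derivative of \<open>p(A + tB)\<close> is not \<open>p'(A + tB) B\<close>. The two
  agree only under the trace, and the formula reaches the logarithm because polynomials can
  approximate \<open>ln\<close> and its derivative at once on an interval containing the spectra of
  all \<open>A + tB\<close>. The sandwich by \<open>C\<close> is chosen because \<open>C\<close>
  lies in the subalgebra: the bimodule property then moves \<open>\<Phi>\<close> past both factors.
  The square \<open>(P\<inverse> - Q\<inverse>) P (P\<inverse> - Q\<inverse>)\<close> takes the
  place of a Jensen inequality for the operator convex inverse, and being an exact square it also
  settles equality. A single intermediate point of the mean value theorem is enough, since agreement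
  at one positive \<open>t\<close> already forces \<open>P = Q\<close>.\<close>

definition rin :: "'h::complex_hilbert \<Rightarrow> 'h \<Rightarrow> real" where
  "rin x y = Re (cinner x y)"

text \<open>Self-adjointness is tested on the form because \<open>adj\<close> is a definite
  description, meaningful only once an adjoint is known to exist. The real part suffices: complex
  linearity recovers the imaginary part by evaluating at \<open>\<i> *\<^sub>C x\<close>.\<close>

definition hermitian :: "('h::complex_hilbert \<Rightarrow>\<^sub>L 'h) \<Rightarrow> bool" where
  "hermitian T \<longleftrightarrow> T \<in> bounded_ops \<and> (\<forall>x y. rin (T x) y = rin x (T y))"

lemma rin_commute: "rin x y = rin y x"
  unfolding rin_def by (metis cinner_commute cnj.simps(1))

lemma rin_self: "rin x x = (norm x)\<^sup>2"
proof -
  have "0 \<le> Re (cinner x x)"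
    using cinner_nonneg[of x] by (simp add: complex_nonneg_Reals_iff)
  then show ?thesis
    by (simp add: rin_def norm_eq_sqrt_cinner)
qed

lemma rin_add_left: "rin (x + y) z = rin x z + rin y z"
  by (simp add: rin_def cinner_add_left)

lemma rin_add_right: "rin z (x + y) = rin z x + rin z y"
  by (metis rin_add_left rin_commute)

lemma rin_scaleR_left: "rin (r *\<^sub>R x) y = r * rin x y"
  by (simp add: rin_def scaleR_scaleC cinner_scaleC_left)

lemma rin_scaleR_right: "rin x (r *\<^sub>R y) = r * rin x y"
  by (metis rin_scaleR_left rin_commute)

text \<open>The class already supplies the triangle inequality; squaring it and cancelling the pure
  terms leaves Cauchy-Schwarz.\<close>

lemma rin_le_norm: "rin x y \<le> norm x * norm y"
proof -
  have "(norm (x + y))\<^sup>2 \<le> (norm x + norm y)\<^sup>2"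
    by (intro power_mono norm_triangle_ineq) simp
  moreover have "(norm (x + y))\<^sup>2 = (norm x)\<^sup>2 + 2 * rin x y + (norm y)\<^sup>2"
    by (simp flip: rin_self add: rin_add_left rin_add_right rin_commute[of y x])
  ultimately show ?thesis
    by (simp add: power2_sum)
qed

lemma bounded_bilinear_rin: "bounded_bilinear (rin :: 'h::complex_hilbert \<Rightarrow> _)"
proof (standard, goal_cases)
  case 5
  have "norm (rin a b) \<le> norm a * norm b * 1" for a b :: 'h
    using rin_le_norm[of a b] rin_le_norm[of "-1 *\<^sub>R a" b] rin_scaleR_left[of "-1" a b]
    by (simp add: abs_le_iff)
  then show ?case by blast
qed (simp_all add: rin_add_left rin_add_right rin_scaleR_left rin_scaleR_right)

interpretation rin: bounded_bilinear rin
  by (rule bounded_bilinear_rin)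

interpretation blinfun_compose: bounded_bilinear "(o\<^sub>L)"
  by (rule bounded_bilinear_blinfun_compose)

lemma rin_eqD: "(\<And>z. rin x z = rin y z) \<Longrightarrow> x = y"
proof -
  assume "\<And>z. rin x z = rin y z"
  then have "rin (x - y) (x - y) = 0" by (simp add: rin.diff_left)
  then show "x = y" by (simp add: rin_self)
qed

lemma cinner_scaleC_right: "cinner x (c *\<^sub>C y) = cnj c * cinner x y"
  by (subst (1 2) cinner_commute) (simp add: cinner_scaleC_left)

lemma Im_cinner: "Im (cinner x y) = - rin (\<i> *\<^sub>C x) y"
  by (simp add: rin_def cinner_scaleC_left)

lemma hermitianD: "hermitian T \<Longrightarrow> rin (T x) y = rin x (T y)"
  by (simp add: hermitian_def)

lemma bounded_opsD: "T \<in> bounded_ops \<Longrightarrow> T (c *\<^sub>C x) = c *\<^sub>C T x"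
  by (simp add: bounded_ops_def)

lemma hermitian_cinner:
  assumes "hermitian T"
  shows "cinner (T x) y = cinner x (T y)"
proof (rule complex_eqI)
  show "Re (cinner (T x) y) = Re (cinner x (T y))"
    using hermitianD[OF assms] by (simp add: rin_def)
  show "Im (cinner (T x) y) = Im (cinner x (T y))"
    using assms hermitianD[OF assms, of "\<i> *\<^sub>C x" y]
    by (simp add: Im_cinner hermitian_def bounded_opsD)
qed

lemma adj_hermitian:
  assumes "hermitian T"
  shows "adj T = T"
  unfolding adj_def
proof (rule the_equality)
  show "\<forall>x y. cinner (T x) y = cinner x (T y)"
    using hermitian_cinner[OF assms] by blast
  fix U :: "'a \<Rightarrow>\<^sub>L 'a"
  assume "\<forall>x y. cinner (T x) y = cinner x (U y)"
  then have "rin (U y) z = rin (T y) z" for y z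
    using hermitianD[OF assms, of z y] by (metis rin_def rin_commute)
  then show "U = T" by (intro blinfun_eqI rin_eqD)
qed

text \<open>Polarization: it suffices to expand the form at \<open>x + y\<close> and at \<open>x + \<i>y\<close>.\<close>

lemma positive_op_hermitian:
  assumes "positive_op T"
  shows "hermitian T"
  unfolding hermitian_def
proof (intro conjI allI)
  show T: "T \<in> bounded_ops" using assms by (simp add: positive_op_def)
  fix x y :: 'a
  have "Im (cinner (T z) z) = 0" for z
    using assms by (simp add: positive_op_def complex_nonneg_Reals_iff)
  \<comment> \<open>The real form of \<open>\<i>T\<close> vanishes on the diagonal; polarizing this
    form at \<open>x + \<i>y\<close> gives the symmetry of \<open>T\<close>.\<close>
  then have z: "rin (T (\<i> *\<^sub>C z)) z = 0" for z
    using T by (simp add: Im_cinner bounded_opsD)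
  have ii: "rin (\<i> *\<^sub>C u) (\<i> *\<^sub>C v) = rin u v" for u v :: 'a
    by (simp add: rin_def cinner_scaleC_left cinner_scaleC_right)
  let ?y = "\<i> *\<^sub>C y"
  have "\<i> *\<^sub>C ?y = - y"
    using scaleR_scaleC[of "-1" y] by (simp add: scaleC_scaleC)
  have "0 = rin (T (\<i> *\<^sub>C (x + ?y))) (x + ?y)" by (rule z[symmetric])
  also have "\<dots> = rin (T (\<i> *\<^sub>C x)) x + rin (T (\<i> *\<^sub>C x)) ?y + (rin (T (\<i> *\<^sub>C ?y)) x + rin (T (\<i> *\<^sub>C ?y)) ?y)"
    by (simp only: scaleC_add_right blinfun.add_right rin_add_left rin_add_right)
  finally have "rin (T (\<i> *\<^sub>C x)) ?y + rin (T (- y)) x = 0"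
    using z[of x] z[of ?y] \<open>\<i> *\<^sub>C ?y = - y\<close> by simp
  then show "rin (T x) y = rin x (T y)"
    using T by (simp add: bounded_opsD ii blinfun.minus_right rin.minus_left rin.minus_right rin_commute)
qed

lemma positive_op_iff: "positive_op T \<longleftrightarrow> hermitian T \<and> (\<forall>x. 0 \<le> rin (T x) x)"
proof
  assume "positive_op T"
  then show "hermitian T \<and> (\<forall>x. 0 \<le> rin (T x) x)"
    using positive_op_hermitian by (simp add: positive_op_def complex_nonneg_Reals_iff rin_def)
next
  assume h: "hermitian T \<and> (\<forall>x. 0 \<le> rin (T x) x)"
  then have "cinner (T x) x = cnj (cinner (T x) x)" for x
    by (metis cinner_commute hermitian_cinner)
  then have "Im (cinner (T x) x) = 0" for x
    by (metis complex_cnj_cancel_iff add.inverse_neutral cnj.simps(2) equal_neg_zero)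
  then show "positive_op T"
    using h unfolding positive_op_def complex_nonneg_Reals_iff by (auto simp: hermitian_def simp flip: rin_def)
qed

lemma bounded_ops_closed_add: "T \<in> bounded_ops \<Longrightarrow> U \<in> bounded_ops \<Longrightarrow> T + U \<in> bounded_ops"
  by (simp add: bounded_ops_def blinfun.add_left scaleC_add_right)

lemma scaleC_scaleR: "c *\<^sub>C r *\<^sub>R x = r *\<^sub>R c *\<^sub>C (x::'h::complex_hilbert)"
  by (simp add: scaleR_scaleC scaleC_scaleC mult.commute)

lemma bounded_ops_closed_scaleR: "T \<in> bounded_ops \<Longrightarrow> r *\<^sub>R T \<in> bounded_ops"
  by (simp add: bounded_ops_def blinfun.scaleR_left scaleC_scaleR)

lemma bounded_ops_closed_compose: "T \<in> bounded_ops \<Longrightarrow> U \<in> bounded_ops \<Longrightarrow> T o\<^sub>L U \<in> bounded_ops"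
  by (simp add: bounded_ops_def)

lemma hermitian_id: "hermitian id_blinfun"
  by (simp add: hermitian_def bounded_ops_def)

lemma hermitian_add: "hermitian T \<Longrightarrow> hermitian U \<Longrightarrow> hermitian (T + U)"
  by (simp add: hermitian_def bounded_ops_closed_add blinfun.add_left rin_add_left rin_add_right)

lemma hermitian_scaleR: "hermitian T \<Longrightarrow> hermitian (r *\<^sub>R T)"
  by (simp add: hermitian_def bounded_ops_closed_scaleR blinfun.scaleR_left rin_scaleR_left rin_scaleR_right)

lemma hermitian_diff: "hermitian T \<Longrightarrow> hermitian U \<Longrightarrow> hermitian (T - U)"
  using hermitian_add[of T "-1 *\<^sub>R U"] hermitian_scaleR[of U "-1"] by simp

lemma hermitian_0: "hermitian 0"
  using hermitian_scaleR[OF hermitian_id, of 0] by simp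

lemma hermitian_compose:
  "hermitian T \<Longrightarrow> hermitian U \<Longrightarrow> T o\<^sub>L U = U o\<^sub>L T \<Longrightarrow> hermitian (T o\<^sub>L U)"
  by (simp add: hermitian_def bounded_ops_closed_compose) (metis blinfun_apply_blinfun_compose)

lemma hermitian_sandwich: "hermitian T \<Longrightarrow> hermitian U \<Longrightarrow> hermitian (U o\<^sub>L T o\<^sub>L U)"
  by (simp add: hermitian_def bounded_ops_closed_compose)

lemma hermitian_jordan: "hermitian T \<Longrightarrow> hermitian U \<Longrightarrow> hermitian ((T o\<^sub>L U) + (U o\<^sub>L T))"
  by (simp add: hermitian_def bounded_ops_closed_compose bounded_ops_closed_add
      blinfun.add_left rin_add_left rin_add_right)

text \<open>Each condition equates two functions of \<open>T\<close> that are continuous in norm.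
  This carries hermiticity over to limits of polynomials and of difference quotients.\<close>

lemma closed_hermitian: "closed {T :: 'h::complex_hilbert \<Rightarrow>\<^sub>L 'h. hermitian T}"
proof -
  have "bounded_linear (\<lambda>T :: 'h \<Rightarrow>\<^sub>L 'h. c *\<^sub>C T x)" for c x
    by (intro bounded_linear_compose[OF bounded_linear_scaleC] blinfun.bounded_linear_left)
  then have cont: "continuous_on UNIV (\<lambda>T :: 'h \<Rightarrow>\<^sub>L 'h. c *\<^sub>C T x)" for c x
    by (intro linear_continuous_on)
  have "closed {T :: 'h \<Rightarrow>\<^sub>L 'h. (\<forall>c x. T (c *\<^sub>C x) = c *\<^sub>C T x) \<and> (\<forall>x y. rin (T x) y = rin x (T y))}"
    by (intro closed_Collect_conj closed_Collect_all closed_Collect_eq cont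
        rin.continuous_on continuous_intros)
  then show ?thesis
    by (simp add: hermitian_def bounded_ops_def)
qed

lemma rin_apply_le:
  fixes T :: "'h::complex_hilbert \<Rightarrow>\<^sub>L 'h"
  shows "rin (T x) x \<le> norm T * (norm x)\<^sup>2"
proof -
  have "rin (T x) x \<le> norm (T x) * norm x" by (rule rin_le_norm)
  also have "\<dots> \<le> norm T * norm x * norm x"
    by (intro mult_right_mono norm_blinfun norm_ge_zero)
  finally show ?thesis by (simp add: power2_eq_square)
qed

lemma rin_apply_ge:
  fixes T :: "'h::complex_hilbert \<Rightarrow>\<^sub>L 'h"
  shows "- norm T * (norm x)\<^sup>2 \<le> rin (T x) x"
  using rin_apply_le[of "- T" x] by (simp add: blinfun.minus_left rin.minus_left)

text \<open>Evaluate the form at \<open>x - K\<inverse> T x\<close>.\<close>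

lemma positive_norm_apply_sq:
  assumes T: "hermitian T" "\<And>x. 0 \<le> rin (T x) x" and K: "norm T \<le> K" "0 < K"
  shows "(norm (T x))\<^sup>2 \<le> K * rin (T x) x"
proof -
  \<comment> \<open>With this step length the quadratic remainder cancels exactly one of the two
    copies of \<open>?s * (norm (T x))\<^sup>2\<close>.\<close>
  let ?s = "1 / K"
  have "0 \<le> rin (T (x - ?s *\<^sub>R T x)) (x - ?s *\<^sub>R T x)" by (rule T(2))
  also have "\<dots> = rin (T x) x - 2 * ?s * (norm (T x))\<^sup>2 + ?s\<^sup>2 * rin (T (T x)) (T x)"
    using hermitianD[OF T(1), of "T x" x]
    by (simp add: blinfun.diff_right blinfun.scaleR_right rin.diff_left rin.diff_right
        rin_scaleR_left rin_scaleR_right rin_self algebra_simps power2_eq_square)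
  also have "\<dots> \<le> rin (T x) x - 2 * ?s * (norm (T x))\<^sup>2 + ?s\<^sup>2 * (K * (norm (T x))\<^sup>2)"
  proof -
    have "rin (T (T x)) (T x) \<le> K * (norm (T x))\<^sup>2"
      using rin_apply_le[of T "T x"] K(1) by (meson mult_right_mono order_trans zero_le_power2)
    then show ?thesis by (intro add_left_mono mult_left_mono) simp_all
  qed
  finally have "0 \<le> rin (T x) x - 2 * ?s * (norm (T x))\<^sup>2 + ?s\<^sup>2 * (K * (norm (T x))\<^sup>2)" .
  moreover have "?s\<^sup>2 * (K * (norm (T x))\<^sup>2) = ?s * (norm (T x))\<^sup>2"
    using K(2) by (simp add: power2_eq_square)
  ultimately have "?s * (norm (T x))\<^sup>2 \<le> rin (T x) x" by simp
  then show ?thesis using K(2) by (simp add: field_simps)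
qed

text \<open>The previous inequality with \<open>K = norm T\<close> gives
  \<open>(norm T)\<^sup>2 \<le> norm T * r\<close>, and one factor cancels. This turns form bounds
  into norm bounds.\<close>

lemma positive_norm_le:
  assumes T: "hermitian T" "\<And>x. 0 \<le> rin (T x) x" "\<And>x. rin (T x) x \<le> r * (norm x)\<^sup>2"
    and r: "0 \<le> r"
  shows "norm T \<le> r"
proof (cases "T = 0")
  case False
  then have K: "0 < norm T" by simp
  have "norm (T x) \<le> sqrt (norm T * r) * norm x" for x
  proof -
    have "(norm (T x))\<^sup>2 \<le> norm T * rin (T x) x"
      by (rule positive_norm_apply_sq[OF T(1,2) order_refl K])
    also have "\<dots> \<le> norm T * (r * (norm x)\<^sup>2)"
      by (intro mult_left_mono T(3)) simp
    also have "\<dots> = (sqrt (norm T * r) * norm x)\<^sup>2"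
      using r by (simp add: power_mult_distrib)
    finally show ?thesis
      by (rule power2_le_imp_le) (simp add: r)
  qed
  then have "norm T \<le> sqrt (norm T * r)"
    by (intro norm_blinfun_bound) (simp_all add: r)
  then have "(norm T)\<^sup>2 \<le> norm T * r"
    using real_le_rsqrt r by (metis K less_imp_le mult_nonneg_nonneg power_mono real_sqrt_pow2)
  then show ?thesis using K by (simp add: power2_eq_square)
qed (simp add: r)

section \<open>Inverses in norm-closed algebras\<close>

lemma blinfun_compose_assoc: "(T o\<^sub>L U) o\<^sub>L V = T o\<^sub>L (U o\<^sub>L V)"
  by (rule blinfun_eqI) simp

lemma blinfun_compose_id [simp]: "T o\<^sub>L id_blinfun = T" "id_blinfun o\<^sub>L T = T"
  by (auto intro: blinfun_eqI)

lemma regularI: "T o\<^sub>L U = id_blinfun \<Longrightarrow> U o\<^sub>L T = id_blinfun \<Longrightarrow> regular T"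
  by (auto simp: regular_def)

lemma op_inv_eq:
  assumes "T o\<^sub>L U = id_blinfun" "U o\<^sub>L T = id_blinfun"
  shows "op_inv T = U"
  unfolding op_inv_def
proof (rule the_equality)
  fix V assume "T o\<^sub>L V = id_blinfun \<and> V o\<^sub>L T = id_blinfun"
  then have "V = V o\<^sub>L (T o\<^sub>L U)" "(V o\<^sub>L T) o\<^sub>L U = U"
    using assms by simp_all
  then show "V = U" by (simp add: blinfun_compose_assoc)
qed (use assms in simp)

lemma op_inv_right: "regular T \<Longrightarrow> T o\<^sub>L op_inv T = id_blinfun"
  and op_inv_left: "regular T \<Longrightarrow> op_inv T o\<^sub>L T = id_blinfun"
  using op_inv_eq by (auto simp: regular_def)

lemma op_inv_apply:
  assumes "regular T"
  shows "T (op_inv T x) = x" "op_inv T (T x) = x"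
  by (metis assms op_inv_right op_inv_left blinfun_apply_blinfun_compose blinfun_apply_id_blinfun id_apply)+

lemma regular_op_inv: "regular T \<Longrightarrow> regular (op_inv T)"
  using op_inv_right op_inv_left regularI by blast

lemma op_inv_op_inv: "regular T \<Longrightarrow> op_inv (op_inv T) = T"
  by (simp add: op_inv_eq op_inv_right op_inv_left)

lemma regular_compose:
  assumes "regular T" "regular U"
  shows "regular (T o\<^sub>L U)"
  by (rule regularI[of _ "op_inv U o\<^sub>L op_inv T"])
    (auto intro!: blinfun_eqI simp: op_inv_apply assms)

text \<open>The inverse of the product yields a right inverse and, by commutativity, a left inverse
  of \<open>T\<close>; associativity makes them equal. It serves for \<open>B - t\<close> as a
  factor of \<open>B\<^sup>2 - t\<^sup>2\<close> and for the square root as a factor of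
  \<open>B\<close>.\<close>

lemma regular_commute_factor:
  assumes "regular (T o\<^sub>L U)" "T o\<^sub>L U = U o\<^sub>L T"
  shows "regular T"
proof -
  let ?J = "op_inv (T o\<^sub>L U)"
  have 1: "T o\<^sub>L (U o\<^sub>L ?J) = id_blinfun"
    using op_inv_right[OF assms(1)] by (simp add: blinfun_compose_assoc)
  have 2: "(?J o\<^sub>L U) o\<^sub>L T = id_blinfun"
    using op_inv_left[OF assms(1)] assms(2) by (simp add: blinfun_compose_assoc)
  have "?J o\<^sub>L U = (?J o\<^sub>L U) o\<^sub>L (T o\<^sub>L (U o\<^sub>L ?J))"
    by (simp add: 1)
  also have "\<dots> = ((?J o\<^sub>L U) o\<^sub>L T) o\<^sub>L (U o\<^sub>L ?J)"
    by (simp only: blinfun_compose_assoc)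
  also have "\<dots> = U o\<^sub>L ?J"
    by (simp only: 2 blinfun_compose_id)
  finally have "?J o\<^sub>L U = U o\<^sub>L ?J" .
  then show ?thesis using 1 2 regularI by metis
qed

lemma regular_scaleR: "regular T \<Longrightarrow> r \<noteq> 0 \<Longrightarrow> regular (r *\<^sub>R T)"
  by (rule regularI[of _ "inverse r *\<^sub>R op_inv T"])
    (auto intro!: blinfun_eqI simp: op_inv_apply blinfun.scaleR_left blinfun.scaleR_right)

lemma hermitian_op_inv:
  assumes T: "hermitian T" and "regular T"
  shows "hermitian (op_inv T)"
  unfolding hermitian_def bounded_ops_def
proof (intro conjI allI CollectI)
  fix c x
  have "op_inv T (c *\<^sub>C x) = op_inv T (T (c *\<^sub>C op_inv T x))"
    using T by (simp add: hermitian_def bounded_opsD op_inv_apply \<open>regular T\<close>)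
  then show "op_inv T (c *\<^sub>C x) = c *\<^sub>C op_inv T x"
    by (simp add: op_inv_apply \<open>regular T\<close>)
  fix y
  have "rin (op_inv T x) (T (op_inv T y)) = rin (T (op_inv T x)) (op_inv T y)"
    using hermitianD[OF T] by simp
  then show "rin (op_inv T x) y = rin x (op_inv T y)"
    by (simp add: op_inv_apply \<open>regular T\<close>)
qed

text \<open>These are just the closure properties used by power series and by limits of real
  polynomials, so the same lemmas apply to \<open>UNIV\<close>, to the von Neumann algebra and to
  its subalgebra.\<close>

definition norm_closed_algebra :: "('h::complex_hilbert \<Rightarrow>\<^sub>L 'h) set \<Rightarrow> bool" where
  "norm_closed_algebra R \<longleftrightarrow> id_blinfun \<in> R \<and> (\<forall>T\<in>R. \<forall>U\<in>R. T + U \<in> R) \<and>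
     (\<forall>r. \<forall>T\<in>R. r *\<^sub>R T \<in> R) \<and> (\<forall>T\<in>R. \<forall>U\<in>R. T o\<^sub>L U \<in> R) \<and> closed R"

lemma norm_closed_algebra_UNIV: "norm_closed_algebra UNIV"
  by (simp add: norm_closed_algebra_def)

context
  fixes R :: "('h::complex_hilbert \<Rightarrow>\<^sub>L 'h) set"
  assumes R: "norm_closed_algebra R"
begin

lemma algebra_id: "id_blinfun \<in> R"
  and algebra_add: "T \<in> R \<Longrightarrow> U \<in> R \<Longrightarrow> T + U \<in> R"
  and algebra_scaleR: "T \<in> R \<Longrightarrow> r *\<^sub>R T \<in> R"
  and algebra_compose: "T \<in> R \<Longrightarrow> U \<in> R \<Longrightarrow> T o\<^sub>L U \<in> R"
  and algebra_closed: "closed R"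
  using R by (auto simp: norm_closed_algebra_def)

lemma algebra_diff: "T \<in> R \<Longrightarrow> U \<in> R \<Longrightarrow> T - U \<in> R"
  using algebra_add[of T "-1 *\<^sub>R U"] algebra_scaleR[of U "-1"] by simp

lemma algebra_0: "0 \<in> R"
  using algebra_scaleR[OF algebra_id, of 0] by simp

lemma algebra_sum: "(\<And>i. i \<in> I \<Longrightarrow> F i \<in> R) \<Longrightarrow> sum F I \<in> R"
  by (induction I rule: infinite_finite_induct) (auto simp: algebra_0 algebra_add)

end

definition op_power :: "('h::complex_hilbert \<Rightarrow>\<^sub>L 'h) \<Rightarrow> nat \<Rightarrow> ('h \<Rightarrow>\<^sub>L 'h)" where
  "op_power T n = ((o\<^sub>L) T ^^ n) id_blinfun"

lemma op_power_0: "op_power T 0 = id_blinfun"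
  and op_power_Suc: "op_power T (Suc n) = T o\<^sub>L op_power T n"
  by (simp_all add: op_power_def)

lemma op_power_commute: "op_power T n o\<^sub>L T = T o\<^sub>L op_power T n"
  by (induction n) (simp_all add: op_power_0 op_power_Suc blinfun_compose_assoc)

lemma norm_op_power: "norm (op_power T n) \<le> norm T ^ n"
proof (induction n)
  case (Suc n)
  then show ?case
    unfolding op_power_Suc power_Suc
    by (intro order_trans[OF norm_blinfun_compose] mult_left_mono) simp_all
qed (simp add: op_power_0 norm_blinfun_id_le)

lemma algebra_op_power: "norm_closed_algebra R \<Longrightarrow> T \<in> R \<Longrightarrow> op_power T n \<in> R"
  by (induction n) (simp_all add: op_power_0 op_power_Suc algebra_id algebra_compose)

text \<open>The partial sums of the geometric series lie in the closed set \<open>R\<close>, so the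
  inverse is produced together with its membership.\<close>

lemma neumann:
  fixes D :: "'h::complex_hilbert \<Rightarrow>\<^sub>L 'h"
  assumes R: "norm_closed_algebra R" and D: "D \<in> R" "norm D < 1"
  shows "regular (id_blinfun - D)" "op_inv (id_blinfun - D) \<in> R"
proof -
  have summ: "summable (op_power D)"
    using norm_op_power D(2)
    by (intro summable_comparison_test'[OF summable_geometric[of "norm D"]]) auto
  let ?J = "suminf (op_power D)"
  have J: "?J \<in> R"
  proof (rule closed_sequentially[OF algebra_closed[OF R]])
    show "(\<lambda>n. \<Sum>i<n. op_power D i) \<longlonglongrightarrow> ?J"
      by (rule summable_LIMSEQ[OF summ])
  qed (intro algebra_sum R algebra_op_power D)
  have "D o\<^sub>L ?J = (\<Sum>n. D o\<^sub>L op_power D n)"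
    by (rule bounded_linear.suminf[OF blinfun_compose.bounded_linear_right summ])
  also have "\<dots> = ?J - id_blinfun"
    using suminf_split_head[OF summ] by (simp add: op_power_0 op_power_Suc)
  finally have DJ: "D o\<^sub>L ?J = ?J - id_blinfun" .
  have "?J o\<^sub>L D = (\<Sum>n. op_power D n o\<^sub>L D)"
    by (rule bounded_linear.suminf[OF blinfun_compose.bounded_linear_left summ])
  also have "\<dots> = ?J - id_blinfun"
    using suminf_split_head[OF summ] by (simp add: op_power_0 op_power_Suc op_power_commute)
  finally have JD: "?J o\<^sub>L D = ?J - id_blinfun" .
  have inv: "(id_blinfun - D) o\<^sub>L ?J = id_blinfun" "?J o\<^sub>L (id_blinfun - D) = id_blinfun"
    using DJ JD by (auto simp: blinfun_compose.diff_left blinfun_compose.diff_right)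
  show "regular (id_blinfun - D)" by (rule regularI[OF inv])
  show "op_inv (id_blinfun - D) \<in> R" using J by (simp add: op_inv_eq[OF inv])
qed

text \<open>Rescaling writes \<open>P = c (I - D)\<close> with
  \<open>0 \<le> D \<le> 1 - m / c\<close>. The Neumann series then gives the inverse inside every
  norm-closed algebra that contains \<open>P\<close>.\<close>

lemma bounded_below_regular:
  fixes P :: "'h::complex_hilbert \<Rightarrow>\<^sub>L 'h"
  assumes R: "norm_closed_algebra R" and P: "P \<in> R" "hermitian P"
    and m: "0 < m" "\<And>x. m * (norm x)\<^sup>2 \<le> rin (P x) x"
  shows "regular P" "op_inv P \<in> R"
proof -
  \<comment> \<open>\<open>c\<close> dominates both \<open>norm P\<close>, which makes
    \<open>D\<close> positive, and \<open>m\<close>, which makes \<open>1 - m / c\<close>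
    nonnegative.\<close>
  define c where "c = norm P + m"
  have c: "0 < c" "m \<le> c" "norm P \<le> c" using m(1) by (simp_all add: c_def add_pos_nonneg add_nonneg_pos)
  define D where "D = id_blinfun - (1 / c) *\<^sub>R P"
  have D: "D \<in> R" "hermitian D"
    unfolding D_def
    by (intro algebra_diff[OF R] algebra_scaleR[OF R] algebra_id[OF R] P
        hermitian_diff hermitian_scaleR hermitian_id)+
  have form: "rin (D x) x = (norm x)\<^sup>2 - rin (P x) x / c" for x
    by (simp add: D_def blinfun.diff_left blinfun.scaleR_left rin.diff_left rin_scaleR_left rin_self)
  have "norm D \<le> 1 - m / c"
  proof (rule positive_norm_le[OF D(2)])
    fix x
    have "rin (P x) x \<le> c * (norm x)\<^sup>2"
      using rin_apply_le[of P x] c(3) by (meson mult_right_mono order_trans zero_le_power2)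
    then show "0 \<le> rin (D x) x" using c(1) by (simp add: form field_simps)
    show "rin (D x) x \<le> (1 - m / c) * (norm x)\<^sup>2"
      using m(2)[of x] c(1) by (simp add: form field_simps)
  qed (use c in simp)
  then have "norm D < 1" using m(1) c(1) by (smt (verit) divide_pos_pos)
  note N = neumann[OF R D(1) this]
  have PD: "P = c *\<^sub>R (id_blinfun - D)" using c(1) by (simp add: D_def)
  have inv: "P o\<^sub>L ((1 / c) *\<^sub>R op_inv (id_blinfun - D)) = id_blinfun"
    "((1 / c) *\<^sub>R op_inv (id_blinfun - D)) o\<^sub>L P = id_blinfun"
    using c(1) unfolding PD
    by (simp_all add: blinfun_compose.scaleR_left blinfun_compose.scaleR_right op_inv_right op_inv_left N(1)
        del: D_def)
  show "regular P" by (rule regularI[OF inv])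
  show "op_inv P \<in> R" unfolding op_inv_eq[OF inv] by (intro algebra_scaleR[OF R] N(2))
qed

lemma positive_regular_bounded_below:
  assumes P: "hermitian P" "\<And>x. 0 \<le> rin (P x) x" and reg: "regular P"
  obtains m where "0 < m" "\<And>x. m * (norm x)\<^sup>2 \<le> rin (P x) x"
proof
  \<comment> \<open>The summands \<open>1\<close> keep both bounds positive even on the zero
    space.\<close>
  define K where "K = norm P + 1"
  define L where "L = norm (op_inv P) + 1"
  have pos: "0 < K" "0 < L" "norm P \<le> K" "norm (op_inv P) \<le> L"
    by (simp_all add: K_def L_def add_nonneg_pos)
  show "0 < 1 / (L\<^sup>2 * K)" using pos by simp
  fix x
  have "norm x \<le> L * norm (P x)"
    using norm_blinfun[of "op_inv P" "P x"] pos(4) op_inv_apply(2)[OF reg, of x]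
    by (metis mult_right_mono norm_ge_zero order_trans)
  then have "(norm x)\<^sup>2 \<le> L\<^sup>2 * (norm (P x))\<^sup>2"
    by (metis norm_ge_zero power_mono power_mult_distrib)
  also have "\<dots> \<le> L\<^sup>2 * (K * rin (P x) x)"
    by (intro mult_left_mono positive_norm_apply_sq P pos) simp_all
  finally show "1 / (L\<^sup>2 * K) * (norm x)\<^sup>2 \<le> rin (P x) x"
    using pos by (simp add: field_simps)
qed

lemma positive_op_inv:
  assumes P: "positive_op P" "regular P"
  shows "positive_op (op_inv P)"
proof -
  have "rin (op_inv P x) x = rin (P (op_inv P x)) (op_inv P x)" for x
    by (simp add: op_inv_apply P(2) rin_commute)
  then show ?thesis
    using P hermitian_op_inv[OF _ P(2)] by (simp add: positive_op_iff)
qed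

section \<open>Functional calculus\<close>

lemma poly_op_eq_sum:
  assumes "degree p \<le> n"
  shows "poly_op p T = (\<Sum>i\<le>n. coeff p i *\<^sub>R op_power T i)"
  unfolding poly_op_def op_power_def
  by (rule sum.mono_neutral_left) (use assms in \<open>auto simp: coeff_eq_0\<close>)

lemma poly_op_pCons: "poly_op (pCons a p) T = a *\<^sub>R id_blinfun + (T o\<^sub>L poly_op p T)"
proof -
  have "poly_op (pCons a p) T = (\<Sum>i\<le>Suc (degree p). coeff (pCons a p) i *\<^sub>R op_power T i)"
    by (rule poly_op_eq_sum) (simp add: degree_pCons_le)
  also have "\<dots> = a *\<^sub>R id_blinfun + (\<Sum>i\<le>degree p. coeff p i *\<^sub>R (T o\<^sub>L op_power T i))"
    by (simp only: sum.atMost_Suc_shift) (simp add: op_power_0 op_power_Suc)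
  also have "(\<Sum>i\<le>degree p. coeff p i *\<^sub>R (T o\<^sub>L op_power T i)) = T o\<^sub>L poly_op p T"
    by (simp add: poly_op_eq_sum[OF order_refl] blinfun_compose.sum_right blinfun_compose.scaleR_right)
  finally show ?thesis .
qed

lemma poly_op_0 [simp]: "poly_op 0 T = 0"
  by (simp add: poly_op_def)

lemma poly_op_1 [simp]: "poly_op 1 T = id_blinfun"
  by (simp add: one_pCons poly_op_pCons blinfun_compose.zero_right)

lemma poly_op_X: "poly_op [:0, 1:] T = T"
  by (simp add: poly_op_pCons blinfun_compose.zero_right)

lemma poly_op_add: "poly_op (p + q) T = poly_op p T + poly_op q T"
proof -
  let ?n = "max (degree p) (degree q)"
  show ?thesis
    using poly_op_eq_sum[of "p + q" ?n T] poly_op_eq_sum[of p ?n T] poly_op_eq_sum[of q ?n T]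
    by (simp add: degree_add_le_max scaleR_add_left sum.distrib)
qed

lemma poly_op_smult: "poly_op (smult c p) T = c *\<^sub>R poly_op p T"
  using poly_op_eq_sum[of "smult c p" "degree p" T] poly_op_eq_sum[of p "degree p" T]
  by (simp add: degree_smult_le scaleR_sum_right)

lemma poly_op_diff: "poly_op (p - q) T = poly_op p T - poly_op q T"
  using poly_op_add[of p "smult (-1) q" T] poly_op_smult[of "-1" q T] by simp

lemma poly_op_mult: "poly_op (p * q) T = poly_op p T o\<^sub>L poly_op q T"
  by (induction p)
    (simp_all add: poly_op_add poly_op_smult poly_op_pCons blinfun_compose.zero_right blinfun_compose.zero_left
      blinfun_compose.add_left blinfun_compose.scaleR_left blinfun_compose_assoc mult_pCons_left)

lemma poly_op_commute: "poly_op p T o\<^sub>L poly_op q T = poly_op q T o\<^sub>L poly_op p T"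
  by (simp flip: poly_op_mult add: mult.commute)

lemma poly_op_pcompose: "poly_op (p \<circ>\<^sub>p q) T = poly_op p (poly_op q T)"
  by (induction p) (simp_all add: pcompose_pCons poly_op_add poly_op_mult poly_op_pCons blinfun_compose.zero_right)

lemma algebra_poly_op: "norm_closed_algebra R \<Longrightarrow> T \<in> R \<Longrightarrow> poly_op p T \<in> R"
  by (induction p) (simp_all add: poly_op_pCons algebra_0 algebra_id algebra_add algebra_scaleR algebra_compose)

lemma hermitian_poly_op:
  assumes "hermitian T"
  shows "hermitian (poly_op p T)"
proof (induction p)
  case (pCons a p)
  have "T o\<^sub>L poly_op p T = poly_op p T o\<^sub>L T"
    using poly_op_commute[of "[:0, 1:]" T p] by (simp add: poly_op_X)
  then show ?case
    unfolding poly_op_pCons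
    by (intro hermitian_add hermitian_scaleR hermitian_id hermitian_compose assms pCons.IH)
qed (simp add: hermitian_0)

section \<open>The spectral bound for real polynomials of a hermitian operator\<close>

definition real_spectrum :: "('h::complex_hilbert \<Rightarrow>\<^sub>L 'h) \<Rightarrow> real set" where
  "real_spectrum T = {t. complex_of_real t \<in> spectrum T}"

lemma real_spectrum_iff: "t \<in> real_spectrum T \<longleftrightarrow> \<not> regular (T - t *\<^sub>R id_blinfun)"
proof -
  have "scale_op (complex_of_real t) id_blinfun = t *\<^sub>R (id_blinfun :: 'a \<Rightarrow>\<^sub>L 'a)"
    by (rule blinfun_eqI) (simp add: scale_op_apply scaleR_scaleC blinfun.scaleR_left)
  then show ?thesis by (simp add: real_spectrum_def spectrum_def)
qed

lemma poly_map_poly_of_real_mult: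
  "poly (map_poly complex_of_real (p * q)) z = poly (map_poly of_real p) z * poly (map_poly of_real q) z"
proof -
  have add: "map_poly complex_of_real (p + q) = map_poly of_real p + map_poly of_real q" for p q
    by (rule poly_eqI) (simp add: coeff_map_poly)
  have smult: "map_poly complex_of_real (smult c p) = smult (of_real c) (map_poly of_real p)" for c p
    by (rule poly_eqI) (simp add: coeff_map_poly)
  show ?thesis
    by (induction p) (simp_all add: mult_pCons_left add smult map_poly_pCons algebra_simps)
qed

lemma poly_map_poly_of_real_of_real:
  "poly (map_poly complex_of_real p) (of_real t) = of_real (poly p t)"
  by (induction p) (simp_all add: map_poly_pCons)

text \<open>A nonreal root \<open>z\<close> of a real polynomial contributes a quadratic factor, whose value at a
  hermitian operator is bounded below by \<open>(Im z)\<^sup>2\<close>.\<close>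

lemma real_poly_quadratic_factor:
  fixes p :: "real poly"
  assumes z: "poly (map_poly of_real p) z = 0" "Im z \<noteq> 0"
  shows "[:(Re z)\<^sup>2 + (Im z)\<^sup>2, - (2 * Re z), 1:] dvd p"
proof -
  let ?s = "[:(Re z)\<^sup>2 + (Im z)\<^sup>2, - (2 * Re z), 1:]"
  have "z * z - 2 * of_real (Re z) * z + of_real ((Re z)\<^sup>2 + (Im z)\<^sup>2) = 0"
    by (simp add: complex_eq_iff power2_eq_square)
  then have s: "poly (map_poly of_real ?s) z = 0"
    by (simp add: map_poly_pCons algebra_simps)
  \<comment> \<open>The remainder has degree at most one, and a real \<open>a + b t\<close> that
    vanishes at a nonreal point is zero.\<close>
  let ?r = "p mod ?s"
  have "poly (map_poly of_real p) z = poly (map_poly of_real (?s * (p div ?s) + ?r)) z"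
    by (simp only: mult_div_mod_eq)
  also have "\<dots> = poly (map_poly of_real (?s * (p div ?s))) z + poly (map_poly of_real ?r) z"
    by (simp only: poly_add[symmetric]) (rule arg_cong[of _ _ "\<lambda>p. poly p z"], rule poly_eqI, simp add: coeff_map_poly)
  also have "\<dots> = poly (map_poly of_real ?r) z"
    unfolding poly_map_poly_of_real_mult s by (simp only: mult_zero_left add_0_left)
  finally have r: "poly (map_poly of_real ?r) z = 0" using z(1) by simp
  have "degree ?r < 2 \<or> ?r = 0"
    using degree_mod_less[of ?s p] by auto
  then have "\<exists>a b. ?r = [:a, b:]"
    by (metis degree_0 degree_pCons_eq_if less_2_cases_iff less_numeral_extra(3) nat.inject one_neq_zero pCons_cases zero_neq_one old.nat.inject pos2 pCons_eq_0_iff degree_eq_zeroE One_nat_def)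
  then obtain a b where ab: "?r = [:a, b:]" by blast
  have "of_real a + z * of_real b = 0"
    using r by (simp add: ab map_poly_pCons)
  then have "a = 0" "b = 0"
    using z(2) by (auto simp: complex_eq_iff)
  then show ?thesis using ab by (simp add: mod_eq_0_iff_dvd)
qed

text \<open>Completing the square gives \<open>(T - Re z)\<^sup>2 + (Im z)\<^sup>2\<close>, and the
  first summand has a nonnegative form.\<close>

lemma regular_quadratic:
  assumes T: "hermitian T" and z: "Im z \<noteq> 0"
  shows "regular (poly_op [:(Re z)\<^sup>2 + (Im z)\<^sup>2, - (2 * Re z), 1:] T)"
proof (rule bounded_below_regular(1)[OF norm_closed_algebra_UNIV UNIV_I])
  show "hermitian (poly_op [:(Re z)\<^sup>2 + (Im z)\<^sup>2, - (2 * Re z), 1:] T)"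
    by (rule hermitian_poly_op[OF T])
  show "0 < (Im z)\<^sup>2" using z by simp
  fix x
  have "0 \<le> rin (T x - Re z *\<^sub>R x) (T x - Re z *\<^sub>R x)"
    by (simp add: rin_self)
  moreover have "rin (poly_op [:(Re z)\<^sup>2 + (Im z)\<^sup>2, - (2 * Re z), 1:] T x) x
      = rin (T x - Re z *\<^sub>R x) (T x - Re z *\<^sub>R x) + (Im z)\<^sup>2 * rin x x"
    using hermitianD[OF T, of "T x" x]
    by (simp add: poly_op_pCons blinfun_compose.zero_right blinfun.add_left blinfun.scaleR_left
        blinfun.add_right blinfun.scaleR_right rin_add_left rin_scaleR_left rin.diff_left rin.diff_right
        rin_scaleR_right rin_commute[of x "T x"] blinfun.diff_left blinfun.diff_right algebra_simps power2_eq_square)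
  ultimately show "(Im z)\<^sup>2 * (norm x)\<^sup>2 \<le> rin (poly_op [:(Re z)\<^sup>2 + (Im z)\<^sup>2, - (2 * Re z), 1:] T x) x"
    by (simp add: rin_self)
qed

text \<open>A complex root of \<open>p\<close> splits off a regular factor: a real root lies outside
  the spectrum, and a nonreal one gives the quadratic above. Nonzeroness of \<open>p\<close> is
  demanded separately because nonemptiness of the spectrum is itself derived from this
  lemma.\<close>

lemma regular_poly_op:
  assumes T: "hermitian T" and "p \<noteq> 0" "\<And>t. t \<in> real_spectrum T \<Longrightarrow> poly p t \<noteq> 0"
  shows "regular (poly_op p T)"
  using assms(2,3)
proof (induction "degree p" arbitrary: p rule: less_induct)
  case less
  show ?case
  proof (cases "degree p = 0")
    case True
    then obtain c where "p = [:c:]" by (rule degree_eq_zeroE)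
    then show ?thesis
      using less.prems(1) regular_scaleR[of id_blinfun c] regularI[of id_blinfun id_blinfun]
      by (simp add: poly_op_pCons blinfun_compose.zero_right)
  next
    case False
    have "degree (map_poly complex_of_real p) = degree p"
      by (rule degree_map_poly) simp
    then have "\<not> constant (poly (map_poly complex_of_real p))"
      using False by (simp add: constant_degree)
    then obtain z where z: "poly (map_poly complex_of_real p) z = 0"
      using fundamental_theorem_of_algebra by blast
    obtain s q where s: "p = s * q" "0 < degree s" "regular (poly_op s T)"
    proof (cases "Im z = 0")
      case True
      then obtain t where t: "z = of_real t" using complex_is_Real_iff Reals_cases by metis
      then have p0: "poly p t = 0"
        using z by (simp add: poly_map_poly_of_real_of_real)
      then obtain q where q: "p = [:- t, 1:] * q"
        by (metis dvdE poly_eq_0_iff_dvd)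
      have "regular (poly_op [:- t, 1:] T)"
        using p0 less.prems(2)[of t] by (auto simp: real_spectrum_iff poly_op_pCons blinfun_compose.zero_right)
      then show ?thesis by (intro that[OF q]) simp_all
    next
      case False
      then obtain q where "p = [:(Re z)\<^sup>2 + (Im z)\<^sup>2, - (2 * Re z), 1:] * q"
        using real_poly_quadratic_factor[OF z] dvdE by metis
      then show ?thesis by (rule that) (simp_all add: regular_quadratic[OF T False])
    qed
    have "s \<noteq> 0" "q \<noteq> 0" using s(1) less.prems(1) by auto
    then have "degree q < degree p" using s by (simp add: degree_mult_eq)
    moreover have "poly q t \<noteq> 0" if "t \<in> real_spectrum T" for t
      using less.prems(2)[OF that] s(1) by auto
    ultimately have "regular (poly_op q T)"
      using less.hyps \<open>q \<noteq> 0\<close> by blast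
    then show ?thesis
      using s(1,3) by (simp add: poly_op_mult regular_compose)
  qed
qed

text \<open>A regular positive operator is bounded below. For this difference, that would bound
  \<open>(norm (Q x))\<^sup>2\<close> by a constant smaller than \<open>(norm Q)\<^sup>2\<close>
  times \<open>(norm x)\<^sup>2\<close>. It replaces the spectral radius formula.\<close>

lemma norm_not_regular:
  fixes Q :: "'h::complex_hilbert \<Rightarrow>\<^sub>L 'h"
  assumes Q: "hermitian Q" "Q \<noteq> 0"
  shows "\<not> regular ((norm Q)\<^sup>2 *\<^sub>R id_blinfun - (Q o\<^sub>L Q))"
proof
  let ?W = "(norm Q)\<^sup>2 *\<^sub>R id_blinfun - (Q o\<^sub>L Q)"
  assume "regular ?W"
  have form: "rin (?W x) x = (norm Q)\<^sup>2 * (norm x)\<^sup>2 - (norm (Q x))\<^sup>2" for x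
    using hermitianD[OF Q(1), of "Q x" x]
    by (simp add: blinfun.diff_left blinfun.scaleR_left rin.diff_left rin_scaleR_left rin_self)
  have "hermitian ?W"
    by (intro hermitian_diff hermitian_scaleR hermitian_id hermitian_compose Q refl)
  moreover have "0 \<le> rin (?W x) x" for x
    unfolding form using norm_blinfun[of Q x] by (simp add: power_mono flip: power_mult_distrib)
  ultimately obtain m where m: "0 < m" "\<And>x. m * (norm x)\<^sup>2 \<le> rin (?W x) x"
    using positive_regular_bounded_below \<open>regular ?W\<close> by metis
  let ?k = "(norm Q)\<^sup>2 - m"
  have le: "(norm (Q x))\<^sup>2 \<le> ?k * (norm x)\<^sup>2" for x
    using m(2)[of x] unfolding form by (simp add: algebra_simps)
  obtain x where "Q x \<noteq> 0" using Q(2) by (metis blinfun_eqI zero_blinfun.rep_eq)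
  then have "x \<noteq> 0" by (metis blinfun.zero_right)
  have "0 \<le> ?k"
    using order_trans[OF zero_le_power2 le[of x]] \<open>x \<noteq> 0\<close> by (simp add: zero_le_mult_iff)
  have "norm (Q x) \<le> sqrt ?k * norm x" for x
    by (rule power2_le_imp_le) (use le[of x] \<open>0 \<le> ?k\<close> in \<open>simp_all add: power_mult_distrib\<close>)
  then have "norm Q \<le> sqrt ?k"
    using \<open>0 \<le> ?k\<close> by (intro norm_blinfun_bound) simp_all
  then have "(norm Q)\<^sup>2 \<le> ?k"
    using \<open>0 \<le> ?k\<close> by (metis norm_ge_zero power_mono real_sqrt_pow2)
  then show False using m(1) by simp
qed

text \<open>The polynomial \<open>(norm T)\<^sup>2 - t\<^sup>2\<close> is not regular at
  \<open>T\<close>, hence has a root in the spectrum.\<close>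

lemma real_spectrum_nonempty:
  assumes T: "hermitian T" and nz: "(id_blinfun :: 'h::complex_hilbert \<Rightarrow>\<^sub>L 'h) \<noteq> 0"
  shows "real_spectrum (T :: 'h \<Rightarrow>\<^sub>L 'h) \<noteq> {}"
proof (cases "T = 0")
  case True
  have "\<not> regular (0 :: 'h \<Rightarrow>\<^sub>L 'h)"
    using nz by (auto simp: regular_def blinfun_compose.zero_left)
  then have "0 \<in> real_spectrum T" using True by (simp add: real_spectrum_iff)
  then show ?thesis by blast
next
  case False
  let ?r = "[:(norm T)\<^sup>2, 0, -1:]"
  have "poly_op ?r T = (norm T)\<^sup>2 *\<^sub>R id_blinfun - (T o\<^sub>L T)"
    by (simp add: poly_op_pCons blinfun_compose.zero_right blinfun_compose.scaleR_right
        blinfun_compose.minus_right)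
  then have "\<not> regular (poly_op ?r T)"
    using norm_not_regular[OF T False] by simp
  then show ?thesis using regular_poly_op[OF T, of ?r] by auto
qed

text \<open>If the norm exceeded \<open>M\<close>, the polynomial
  \<open>(norm Q)\<^sup>2 - p\<^sup>2\<close> with \<open>Q = p(T)\<close> would be positive on the
  spectrum and so regular at \<open>T\<close>, against \<open>norm_not_regular\<close>.\<close>

lemma norm_poly_op_le:
  fixes T :: "'h::complex_hilbert \<Rightarrow>\<^sub>L 'h"
  assumes T: "hermitian T" and M: "0 \<le> M" "\<And>t. t \<in> real_spectrum T \<Longrightarrow> \<bar>poly p t\<bar> \<le> M"
  shows "norm (poly_op p T) \<le> M"
proof (rule ccontr)
  let ?Q = "poly_op p T"
  assume "\<not> norm ?Q \<le> M"
  then have N: "M < norm ?Q" by simp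
  then have "?Q \<noteq> 0" using M(1) by auto
  let ?r = "[:(norm ?Q)\<^sup>2:] - p * p"
  have r: "0 < poly ?r t" if "t \<in> real_spectrum T" for t
  proof -
    have "\<bar>poly p t\<bar>\<^sup>2 < (norm ?Q)\<^sup>2"
      using M(2)[OF that] N by (intro power_strict_mono) auto
    then show ?thesis by (simp add: power2_eq_square)
  qed
  have "(id_blinfun :: 'h \<Rightarrow>\<^sub>L 'h) \<noteq> 0"
    using \<open>?Q \<noteq> 0\<close> by (metis blinfun_compose_id(1) blinfun_compose.zero_right)
  \<comment> \<open>A spectral point is needed to see that \<open>?r\<close> is not the zero
    polynomial.\<close>
  then obtain t where "t \<in> real_spectrum T"
    using real_spectrum_nonempty[OF T] by blast
  then have "?r \<noteq> 0" using r by (metis poly_0 less_irrefl)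
  then have "regular (poly_op ?r T)"
    by (rule regular_poly_op[OF T]) (metis r less_irrefl)
  moreover have "poly_op ?r T = (norm ?Q)\<^sup>2 *\<^sub>R id_blinfun - (?Q o\<^sub>L ?Q)"
    by (simp add: poly_op_diff poly_op_mult poly_op_pCons blinfun_compose.zero_right)
  ultimately show False
    using norm_not_regular[OF hermitian_poly_op[OF T] \<open>?Q \<noteq> 0\<close>] by simp
qed

text \<open>The spectral bound turns uniform closeness on the spectrum into norm closeness, so all
  approximating sequences share one limit. The given sequence \<open>p\<close> also makes the
  description in \<open>cfc\<close> unique: without any such sequence every operator would satisfy
  it.\<close>

lemma cfc_tendsto:
  fixes T :: "'h::complex_hilbert \<Rightarrow>\<^sub>L 'h"
  assumes T: "hermitian T" and p: "uniform_limit (real_spectrum T) (\<lambda>n. poly (p n)) f sequentially"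
  shows "(\<lambda>n. poly_op (p n) T) \<longlonglongrightarrow> cfc f T"
proof -
  have dist: "norm (poly_op p T - poly_op q T) \<le> 2 * e"
    if pq: "\<forall>t\<in>real_spectrum T. dist (poly p t) (f t) < e" "\<forall>t\<in>real_spectrum T. dist (poly q t) (f t) < e" and "0 < e"
    for p q e
  proof -
    have "\<bar>poly (p - q) t\<bar> \<le> 2 * e" if t: "t \<in> real_spectrum T" for t
      using bspec[OF pq(1) t] bspec[OF pq(2) t] by (simp add: dist_real_def)
    then show ?thesis
      using norm_poly_op_le[OF T, of "2 * e" "p - q"] \<open>0 < e\<close> by (simp add: poly_op_diff)
  qed
  have ev: "\<exists>N. \<forall>n\<ge>N. \<forall>t\<in>real_spectrum T. dist (poly (q n) t) (f t) < e"
    if "uniform_limit (real_spectrum T) (\<lambda>n. poly (q n)) f sequentially" "0 < e" for q e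
    using that by (simp add: uniform_limit_sequentially_iff)
  have "Cauchy (\<lambda>n. poly_op (p n) T)"
  proof (rule CauchyI)
    fix e :: real assume "0 < e"
    then obtain N where N: "\<forall>n\<ge>N. \<forall>t\<in>real_spectrum T. dist (poly (p n) t) (f t) < e / 3"
      using ev[OF p, of "e / 3"] by auto
    have "norm (poly_op (p m) T - poly_op (p n) T) < e" if "m \<ge> N" "n \<ge> N" for m n
      using dist[of "p m" "e / 3" "p n"] N that \<open>0 < e\<close> by auto
    then show "\<exists>N. \<forall>m\<ge>N. \<forall>n\<ge>N. norm (poly_op (p m) T - poly_op (p n) T) < e" by blast
  qed
  then obtain L where L: "(\<lambda>n. poly_op (p n) T) \<longlonglongrightarrow> L"
    using Cauchy_convergent convergent_def by blast
  have "cfc f T = L"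
    unfolding cfc_def real_spectrum_def[symmetric]
  proof (rule the_equality)
    show "\<forall>q. uniform_limit (real_spectrum T) (\<lambda>n. poly (q n)) f sequentially
        \<longrightarrow> (\<lambda>n. poly_op (q n) T) \<longlonglongrightarrow> L"
    proof (intro allI impI)
      fix q assume q: "uniform_limit (real_spectrum T) (\<lambda>n. poly (q n)) f sequentially"
      have "(\<lambda>n. poly_op (q n) T - poly_op (p n) T) \<longlonglongrightarrow> 0"
      proof (rule LIMSEQ_I)
        fix e :: real assume "0 < e"
        obtain N1 where N1: "\<forall>n\<ge>N1. \<forall>t\<in>real_spectrum T. dist (poly (p n) t) (f t) < e / 3"
          using ev[OF p, of "e / 3"] \<open>0 < e\<close> by auto
        obtain N2 where N2: "\<forall>n\<ge>N2. \<forall>t\<in>real_spectrum T. dist (poly (q n) t) (f t) < e / 3"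
          using ev[OF q, of "e / 3"] \<open>0 < e\<close> by auto
        have "norm (poly_op (q n) T - poly_op (p n) T - 0) < e" if "n \<ge> max N1 N2" for n
          using dist[of "q n" "e / 3" "p n"] N1 N2 that \<open>0 < e\<close> by auto
        then show "\<exists>N. \<forall>n\<ge>N. norm (poly_op (q n) T - poly_op (p n) T - 0) < e" by blast
      qed
      from tendsto_add[OF this L] show "(\<lambda>n. poly_op (q n) T) \<longlonglongrightarrow> L" by simp
    qed
  next
    fix U assume "\<forall>q. uniform_limit (real_spectrum T) (\<lambda>n. poly (q n)) f sequentially
        \<longrightarrow> (\<lambda>n. poly_op (q n) T) \<longlonglongrightarrow> U"
    then show "U = L" using p L LIMSEQ_unique by blast
  qed
  then show ?thesis using L by simp
qed

section \<open>Weierstrass approximation and closure properties of the calculus\<close>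

lemma poly_mult_fun: "poly (p * q) = (\<lambda>x. poly p x * poly q x)"
  by (simp add: fun_eq_iff)

lemma weierstrass_poly:
  fixes f :: "real \<Rightarrow> real"
  assumes "continuous_on {a..b} f"
  shows "\<exists>p. uniform_limit {a..b} (\<lambda>n. poly (p n)) f sequentially"
proof -
  have "\<exists>p. \<forall>x\<in>{a..b}. \<bar>f x - poly p x\<bar> < inverse (real (Suc n))" for n
  proof -
    have "0 < inverse (real (Suc n))" by simp
    then obtain g where g: "real_polynomial_function g" "\<And>x. x \<in> {a..b} \<Longrightarrow> \<bar>f x - g x\<bar> < inverse (real (Suc n))"
      using Stone_Weierstrass_real_polynomial_function[OF compact_Icc assms] by blast
    obtain c k where "g = (\<lambda>x. \<Sum>i\<le>k. c i * x ^ i)"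
      using g(1) unfolding real_polynomial_function_iff_sum by blast
    then have "poly (\<Sum>i\<le>k. monom (c i) i) x = g x" for x
      by (simp add: poly_sum poly_monom)
    with g(2) show ?thesis by (intro exI[of _ "\<Sum>i\<le>k. monom (c i) i"]) simp
  qed
  then obtain p where p: "\<forall>n. \<forall>x\<in>{a..b}. \<bar>f x - poly (p n) x\<bar> < inverse (real (Suc n))"
    using choice[of "\<lambda>n p. \<forall>x\<in>{a..b}. \<bar>f x - poly p x\<bar> < inverse (real (Suc n))"] by blast
  have "uniform_limit {a..b} (\<lambda>n. poly (p n)) f sequentially"
  proof (rule uniform_limitI)
    fix e :: real assume "0 < e"
    then have "\<forall>\<^sub>F n in sequentially. inverse (real (Suc n)) < e"
      using LIMSEQ_inverse_real_of_nat order_tendstoD(2) by blast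
    then show "\<forall>\<^sub>F n in sequentially. \<forall>x\<in>{a..b}. dist (poly (p n) x) (f x) < e"
    proof eventually_elim
      case (elim n)
      have "dist (poly (p n) x) (f x) < e" if "x \<in> {a..b}" for x
        using p that elim unfolding dist_real_def by (subst abs_minus_commute) (meson order_less_trans)
      then show ?case by blast
    qed
  qed
  then show ?thesis by blast
qed

lemma cfc_approx:
  fixes T :: "'h::complex_hilbert \<Rightarrow>\<^sub>L 'h"
  assumes "hermitian T" "real_spectrum T \<subseteq> {a..b}" "continuous_on {a..b} f"
  shows "\<exists>p. uniform_limit {a..b} (\<lambda>n. poly (p n)) f sequentially \<and> (\<lambda>n. poly_op (p n) T) \<longlonglongrightarrow> cfc f T"
  using weierstrass_poly[OF assms(3)] cfc_tendsto[OF assms(1) uniform_limit_on_subset[OF _ assms(2)]] by blast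

lemma hermitian_cfc:
  fixes T :: "'h::complex_hilbert \<Rightarrow>\<^sub>L 'h"
  assumes "hermitian T" "real_spectrum T \<subseteq> {a..b}" "continuous_on {a..b} f"
  shows "hermitian (cfc f T)"
proof -
  obtain p where lim: "(\<lambda>n. poly_op (p n) T) \<longlonglongrightarrow> cfc f T"
    using cfc_approx[OF assms] by blast
  have "cfc f T \<in> {U. hermitian U}"
    by (rule closed_sequentially[OF closed_hermitian _ lim]) (simp add: hermitian_poly_op assms)
  then show ?thesis by simp
qed

lemma algebra_cfc:
  fixes T :: "'h::complex_hilbert \<Rightarrow>\<^sub>L 'h"
  assumes "norm_closed_algebra R" "T \<in> R"
    and "hermitian T" "real_spectrum T \<subseteq> {a..b}" "continuous_on {a..b} f"
  shows "cfc f T \<in> R"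
proof -
  obtain p where lim: "(\<lambda>n. poly_op (p n) T) \<longlonglongrightarrow> cfc f T"
    using cfc_approx[OF assms(3-5)] by blast
  show ?thesis
    by (rule closed_sequentially[OF algebra_closed[OF assms(1)] _ lim]) (rule algebra_poly_op[OF assms(1,2)])
qed

text \<open>For \<open>t\<close> outside the interval, either \<open>T - t\<close> or
  \<open>t - T\<close> is bounded below by a positive constant.\<close>

lemma real_spectrum_subset:
  fixes T :: "'h::complex_hilbert \<Rightarrow>\<^sub>L 'h"
  assumes T: "hermitian T" and m: "\<And>x. m * (norm x)\<^sup>2 \<le> rin (T x) x" and M: "norm T \<le> M"
  shows "real_spectrum T \<subseteq> {m..M}"
proof
  fix t assume "t \<in> real_spectrum T"
  then have t: "\<not> regular (T - t *\<^sub>R id_blinfun)" by (simp add: real_spectrum_iff)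
  have h: "hermitian (T - t *\<^sub>R id_blinfun)" "hermitian (t *\<^sub>R id_blinfun - T)"
    by (intro hermitian_diff hermitian_scaleR hermitian_id T)+
  have "m \<le> t"
  proof (rule ccontr)
    assume "\<not> m \<le> t"
    moreover have "(m - t) * (norm x)\<^sup>2 \<le> rin ((T - t *\<^sub>R id_blinfun) x) x" for x
      using m[of x] by (simp add: blinfun.diff_left blinfun.scaleR_left rin.diff_left rin_scaleR_left rin_self algebra_simps)
    ultimately show False
      using bounded_below_regular(1)[OF norm_closed_algebra_UNIV UNIV_I h(1), of "m - t"] t by simp
  qed
  moreover have "t \<le> M"
  proof (rule ccontr)
    assume "\<not> t \<le> M"
    moreover have "(t - M) * (norm x)\<^sup>2 \<le> rin ((t *\<^sub>R id_blinfun - T) x) x" for x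
      using rin_apply_le[of T x] mult_right_mono[OF M zero_le_power2[of "norm x"]]
      by (simp add: blinfun.diff_left blinfun.scaleR_left rin.diff_left rin_scaleR_left rin_self algebra_simps)
    ultimately have "regular (t *\<^sub>R id_blinfun - T)"
      using bounded_below_regular(1)[OF norm_closed_algebra_UNIV UNIV_I h(2), of "t - M"] by simp
    then show False using t regular_scaleR[of "t *\<^sub>R id_blinfun - T" "-1"] by simp
  qed
  ultimately show "t \<in> {m..M}" by simp
qed

section \<open>Square roots of positive operators\<close>

context
  fixes B :: "'h::complex_hilbert \<Rightarrow>\<^sub>L 'h"
  assumes B: "positive_op B"
begin

lemma positive_real_spectrum: "real_spectrum B \<subseteq> {0..norm B}"
  using B by (intro real_spectrum_subset) (simp_all add: positive_op_iff)

lemma hermitian_op_sqrt: "hermitian (op_sqrt B)"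
  unfolding op_sqrt_def
  using B by (intro hermitian_cfc[OF _ positive_real_spectrum] continuous_intros) (simp add: positive_op_iff)

lemma algebra_op_sqrt: "norm_closed_algebra R \<Longrightarrow> B \<in> R \<Longrightarrow> op_sqrt B \<in> R"
  unfolding op_sqrt_def
  using B by (intro algebra_cfc[OF _ _ _ positive_real_spectrum] continuous_intros) (simp_all add: positive_op_iff)

lemma op_sqrt_square: "op_sqrt B o\<^sub>L op_sqrt B = B"
proof -
  have h: "hermitian B" using B by (simp add: positive_op_iff)
  have cont: "continuous_on {0..norm B} sqrt" by (intro continuous_intros)
  obtain p where p: "uniform_limit {0..norm B} (\<lambda>n. poly (p n)) sqrt sequentially"
    and lim: "(\<lambda>n. poly_op (p n) B) \<longlonglongrightarrow> cfc sqrt B"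
    using cfc_approx[OF h positive_real_spectrum cont] by blast
  \<comment> \<open>Products of uniform limits converge uniformly only when the limits are
    bounded.\<close>
  have "bounded (sqrt ` {0..norm B})"
    by (intro compact_imp_bounded compact_continuous_image cont compact_Icc)
  then have "uniform_limit {0..norm B} (\<lambda>n x. poly (p n) x * poly (p n) x) (\<lambda>x. sqrt x * sqrt x) sequentially"
    by (intro uniform_lim_mult p)
  then have "uniform_limit (real_spectrum B) (\<lambda>n. poly (p n * p n)) (\<lambda>x. sqrt x * sqrt x) sequentially"
    using uniform_limit_on_subset[OF _ positive_real_spectrum] by (simp only: poly_mult_fun)
  then have "(\<lambda>n. poly_op (p n * p n) B) \<longlonglongrightarrow> cfc (\<lambda>x. sqrt x * sqrt x) B"
    by (rule cfc_tendsto[OF h])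
  moreover have "(\<lambda>n. poly_op (p n * p n) B) \<longlonglongrightarrow> (op_sqrt B o\<^sub>L op_sqrt B)"
    unfolding poly_op_mult op_sqrt_def by (intro blinfun_compose.tendsto lim)
  \<comment> \<open>On the nonnegative spectrum \<open>sqrt x * sqrt x = x\<close>, so the constant
    sequence \<open>[:0, 1:]\<close> approximates the same function and identifies the limit as
    \<open>B\<close>.\<close>
  moreover have "uniform_limit (real_spectrum B) (\<lambda>n::nat. poly [:0, 1:]) (\<lambda>x. sqrt x * sqrt x) sequentially"
    using positive_real_spectrum by (auto intro!: uniform_limitI always_eventually)
  then have "(\<lambda>n::nat. poly_op [:0, 1:] B) \<longlonglongrightarrow> cfc (\<lambda>x. sqrt x * sqrt x) B"
    by (rule cfc_tendsto[OF h])
  then have "cfc (\<lambda>x. sqrt x * sqrt x) B = B"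
    by (simp add: poly_op_X LIMSEQ_const_iff)
  ultimately show ?thesis by (metis LIMSEQ_unique)
qed

text \<open>Squares of spectral points of \<open>B\<close> are spectral points of
  \<open>B\<^sup>2\<close>. Approximants of \<open>sqrt\<close> composed with squaring therefore
  converge on the spectrum of \<open>B\<close> to \<open>sqrt (x\<^sup>2) = x\<close>. This removes
  the square root from the determinant of a positive operator.\<close>

lemma op_sqrt_of_square: "op_sqrt (B o\<^sub>L B) = B"
proof -
  have h: "hermitian B" using B by (simp add: positive_op_iff)
  let ?T = "B o\<^sub>L B"
  have hT: "hermitian ?T" by (intro hermitian_compose h refl)
  have T: "positive_op ?T"
    using hT hermitianD[OF h] by (simp add: positive_op_iff rin_self)
  have spec: "t\<^sup>2 \<in> real_spectrum ?T" if t: "t \<in> real_spectrum B" for t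
    unfolding real_spectrum_iff
  proof
    assume "regular (?T - t\<^sup>2 *\<^sub>R id_blinfun)"
    also have "?T - t\<^sup>2 *\<^sub>R id_blinfun = (B - t *\<^sub>R id_blinfun) o\<^sub>L (B + t *\<^sub>R id_blinfun)"
      by (rule blinfun_eqI) (simp add: blinfun.diff_left blinfun.add_left blinfun.scaleR_left
          blinfun.diff_right blinfun.add_right blinfun.scaleR_right power2_eq_square algebra_simps)
    finally have "regular (B - t *\<^sub>R id_blinfun)"
      by (rule regular_commute_factor)
        (rule blinfun_eqI, simp add: blinfun.diff_left blinfun.add_left blinfun.scaleR_left
          blinfun.diff_right blinfun.add_right blinfun.scaleR_right algebra_simps)
    then show False using t by (simp add: real_spectrum_iff)
  qed
  have hTspec: "real_spectrum ?T \<subseteq> {0..norm ?T}"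
    using T hT by (intro real_spectrum_subset) (simp_all add: positive_op_iff)
  have cont: "continuous_on {0..norm ?T} sqrt" by (intro continuous_intros)
  obtain p where p: "uniform_limit {0..norm ?T} (\<lambda>n. poly (p n)) sqrt sequentially"
    and lim: "(\<lambda>n. poly_op (p n) ?T) \<longlonglongrightarrow> cfc sqrt ?T"
    using cfc_approx[OF hT hTspec cont] by blast
  let ?q = "\<lambda>n. p n \<circ>\<^sub>p [:0, 0, 1:]"
  have sq: "poly_op [:0, 0, 1:] B = ?T"
    by (simp add: poly_op_pCons blinfun_compose.zero_right)
  have "uniform_limit (real_spectrum B) (\<lambda>n x. poly (p n) (x\<^sup>2)) (\<lambda>x. sqrt (x\<^sup>2)) sequentially"
    by (rule uniform_limit_compose'[OF p]) (use spec hTspec in blast)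
  moreover have "poly (?q n) = (\<lambda>x. poly (p n) (x\<^sup>2))" for n
    by (simp add: fun_eq_iff poly_pcompose power2_eq_square)
  ultimately have "uniform_limit (real_spectrum B) (\<lambda>n. poly (?q n)) (\<lambda>x. sqrt (x\<^sup>2)) sequentially"
    by (simp only:)
  then have "(\<lambda>n. poly_op (?q n) B) \<longlonglongrightarrow> cfc (\<lambda>x. sqrt (x\<^sup>2)) B"
    by (rule cfc_tendsto[OF h])
  then have "(\<lambda>n. poly_op (p n) ?T) \<longlonglongrightarrow> cfc (\<lambda>x. sqrt (x\<^sup>2)) B"
    by (simp only: poly_op_pcompose sq)
  moreover have "uniform_limit (real_spectrum B) (\<lambda>n::nat. poly [:0, 1:]) (\<lambda>x. sqrt (x\<^sup>2)) sequentially"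
    using positive_real_spectrum by (auto intro!: uniform_limitI always_eventually)
  then have "(\<lambda>n::nat. poly_op [:0, 1:] B) \<longlonglongrightarrow> cfc (\<lambda>x. sqrt (x\<^sup>2)) B"
    by (rule cfc_tendsto[OF h])
  then have "cfc (\<lambda>x. sqrt (x\<^sup>2)) B = B"
    by (simp add: poly_op_X LIMSEQ_const_iff)
  ultimately show ?thesis unfolding op_sqrt_def using lim by (metis LIMSEQ_unique)
qed

lemma fk_det_positive: "fk_det \<tau> B = exp (Re (\<tau> (op_log B)))"
  using B by (simp add: fk_det_def adj_hermitian op_sqrt_of_square positive_op_iff)

end

section \<open>The derivative of the trace of the logarithm\<close>

lemma poly_antiderivative: "\<exists>P. pderiv P = (q :: real poly)"
proof
  have "pderiv (\<Sum>i\<le>degree q. monom (coeff q i / real (Suc i)) (Suc i)) = (\<Sum>i\<le>degree q. monom (coeff q i) i)"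
    using higher_pderiv_sum[of 1 "\<lambda>i. monom (coeff q i / real (Suc i)) (Suc i)" "{..degree q}"]
    by (simp add: pderiv_monom del: of_nat_Suc)
  then show "pderiv (\<Sum>i\<le>degree q. monom (coeff q i / real (Suc i)) (Suc i)) = q"
    by (simp add: poly_as_sum_of_monoms)
qed

text \<open>Integrate polynomial approximations of \<open>1/x\<close>.\<close>

lemma ln_poly_approx:
  fixes m M :: real
  assumes "0 < m" "m \<le> M"
  obtains p where "uniform_limit {m..M} (\<lambda>n. poly (p n)) ln sequentially"
    "uniform_limit {m..M} (\<lambda>n. poly (pderiv (p n))) inverse sequentially"
proof -
  have "continuous_on {m..M} inverse"
    using assms(1) by (intro continuous_intros) auto
  then obtain q where q: "uniform_limit {m..M} (\<lambda>n. poly (q n)) inverse sequentially"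
    using weierstrass_poly by blast
  obtain P where P: "\<forall>n. pderiv (P n) = q n"
    using choice[of "\<lambda>n P. pderiv P = q n"] poly_antiderivative by blast
  \<comment> \<open>The constant of integration makes \<open>p n\<close> agree with
    \<open>ln\<close> at \<open>m\<close>, so the error elsewhere is controlled by the derivative
    alone.\<close>
  define p where "p n = P n + [:ln m - poly (P n) m:]" for n
  have p: "pderiv (p n) = q n" "poly (p n) m = ln m" for n
    by (simp_all add: p_def pderiv_add P)
  have "uniform_limit {m..M} (\<lambda>n. poly (p n)) ln sequentially"
  proof (rule uniform_limitI)
    fix e :: real assume "0 < e"
    \<comment> \<open>The summand \<open>1\<close> covers the degenerate interval
      \<open>m = M\<close> and makes \<open>d * (M - m) < e\<close> strict.\<close>
    define d where "d = e / (M - m + 1)"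
    have d: "0 < d" using \<open>0 < e\<close> assms(2) by (simp add: d_def)
    have de: "d * (M - m) < e"
    proof -
      have "d * (M - m) < d * (M - m + 1)" using d by simp
      also have "\<dots> = e" using assms(2) by (simp add: d_def)
      finally show ?thesis .
    qed
    show "\<forall>\<^sub>F n in sequentially. \<forall>x\<in>{m..M}. dist (poly (p n) x) (ln x) < e"
      using uniform_limitD[OF q d]
    proof eventually_elim
      case (elim n)
      have "dist (poly (p n) x) (ln x) < e" if x: "x \<in> {m..M}" for x
      proof -
        have "norm ((poly (p n) x - ln x) - (poly (p n) m - ln m)) \<le> d * norm (x - m)"
        proof (rule field_differentiable_bound[of "{m..M}" _ "\<lambda>x. poly (q n) x - inverse x"])
          fix z assume z: "z \<in> {m..M}"
          then have "((\<lambda>x. poly (p n) x - ln x) has_real_derivative poly (q n) z - inverse z) (at z)"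
            using assms(1) p(1)[of n] by (auto intro!: derivative_eq_intros simp: divide_inverse)
          then show "((\<lambda>x. poly (p n) x - ln x) has_real_derivative poly (q n) z - inverse z) (at z within {m..M})"
            by (rule has_field_derivative_at_within)
          show "norm (poly (q n) z - inverse z) \<le> d"
            using bspec[OF elim z] by (simp add: dist_real_def)
        qed (use x in auto)
        also have "\<dots> \<le> d * (M - m)"
          using x d by (intro mult_left_mono) auto
        finally show ?thesis using de p(2)[of n] by (simp add: dist_real_def)
      qed
      then show ?case by blast
    qed
  qed
  then show ?thesis using that[of p] p(1) q by simp
qed

text \<open>\<open>tr\<close> stands for the real part of the trace.\<close>

locale faithful_trace =
  fixes R :: "('h::complex_hilbert \<Rightarrow>\<^sub>L 'h) set" and tr :: "('h \<Rightarrow>\<^sub>L 'h) \<Rightarrow> real"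
  assumes algebra: "norm_closed_algebra R"
    and tr_add: "T \<in> R \<Longrightarrow> U \<in> R \<Longrightarrow> tr (T + U) = tr T + tr U"
    and tr_scaleR: "T \<in> R \<Longrightarrow> tr (r *\<^sub>R T) = r * tr T"
    and tr_nonneg: "T \<in> R \<Longrightarrow> positive_op T \<Longrightarrow> 0 \<le> tr T"
    and tr_id: "tr id_blinfun = 1"
    and tr_commute: "T \<in> R \<Longrightarrow> U \<in> R \<Longrightarrow> tr (T o\<^sub>L U) = tr (U o\<^sub>L T)"
    and tr_faithful: "T \<in> R \<Longrightarrow> positive_op T \<Longrightarrow> tr T = 0 \<Longrightarrow> T = 0"
begin

lemmas closures = algebra_id[OF algebra] algebra_add[OF algebra] algebra_diff[OF algebra]
  algebra_scaleR[OF algebra] algebra_compose[OF algebra]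

lemma tr_diff: "T \<in> R \<Longrightarrow> U \<in> R \<Longrightarrow> tr (T - U) = tr T - tr U"
  using tr_add[of T "-1 *\<^sub>R U"] tr_scaleR[of U "-1"] closures(4)[of U "-1"] by simp

text \<open>Positivity of the trace is applied to \<open>norm T \<plusminus> T\<close>.\<close>

lemma tr_abs_le:
  assumes T: "T \<in> R" "hermitian T"
  shows "\<bar>tr T\<bar> \<le> norm T"
proof -
  let ?N = "norm T *\<^sub>R (id_blinfun :: 'h \<Rightarrow>\<^sub>L 'h)"
  have N: "?N \<in> R" "hermitian ?N" by (intro closures hermitian_scaleR hermitian_id)+
  have form: "rin ((?N - T) x) x = norm T * (norm x)\<^sup>2 - rin (T x) x"
    "rin ((?N + T) x) x = norm T * (norm x)\<^sup>2 + rin (T x) x" for x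
    by (simp_all add: blinfun.diff_left blinfun.add_left blinfun.scaleR_left rin.diff_left rin_add_left
        rin_scaleR_left rin_self)
  have "0 \<le> rin ((?N - T) x) x" "0 \<le> rin ((?N + T) x) x" for x
    unfolding form using rin_apply_le[of T x] rin_apply_ge[of T x] by simp_all
  moreover have "hermitian (?N - T)" "hermitian (?N + T)"
    by (intro hermitian_diff hermitian_add N T)+
  ultimately have "positive_op (?N - T)" "positive_op (?N + T)"
    by (simp_all add: positive_op_iff)
  then have "0 \<le> tr (?N - T)" "0 \<le> tr (?N + T)"
    by (simp_all add: tr_nonneg closures N T)
  then show ?thesis
    using N T by (simp add: tr_diff tr_add tr_scaleR tr_id closures)
qed

text \<open>The product need not be hermitian, but its symmetrization is, and by traciality that has
  twice the trace.\<close>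

lemma tr_abs_compose_le:
  assumes T: "T \<in> R" "hermitian T" and U: "U \<in> R" "hermitian U"
  shows "\<bar>tr (T o\<^sub>L U)\<bar> \<le> norm T * norm U"
proof -
  let ?J = "(T o\<^sub>L U) + (U o\<^sub>L T)"
  have "\<bar>tr ?J\<bar> \<le> norm ?J"
    by (intro tr_abs_le closures hermitian_jordan T U)
  also have "\<dots> \<le> norm T * norm U + norm U * norm T"
    by (intro order_trans[OF norm_triangle_ineq] add_mono norm_blinfun_compose)
  also have "tr ?J = 2 * tr (T o\<^sub>L U)"
    using tr_commute[OF T(1) U(1)] by (simp add: tr_add closures T U)
  finally show ?thesis by simp
qed

lemma tendsto_tr:
  assumes "(F \<longlongrightarrow> T) G" "\<And>x. F x \<in> R" "\<And>x. hermitian (F x)" "T \<in> R" "hermitian T"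
  shows "((\<lambda>x. tr (F x)) \<longlongrightarrow> tr T) G"
proof -
  have "((\<lambda>x. F x - T) \<longlongrightarrow> 0) G"
    using assms(1) by (simp add: LIM_zero_iff)
  then have "((\<lambda>x. tr (F x) - tr T) \<longlongrightarrow> 0) G"
    by (rule tendsto_0_le[where K = 1])
      (auto intro!: always_eventually simp flip: tr_diff simp: assms tr_abs_le closures hermitian_diff)
  then show ?thesis by (simp add: LIM_zero_iff)
qed

text \<open>Continuity of \<open>tr\<close> is at hand only on hermitian members of
  \<open>R\<close>. The difference quotients are such, and so is their limit, by closedness.\<close>

lemma has_real_derivative_tr:
  assumes G: "(G has_vector_derivative G') (at t)" and mem: "\<And>s. G s \<in> R" "\<And>s. hermitian (G s)"
  shows "((\<lambda>s. tr (G s)) has_real_derivative tr G') (at t)"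
proof -
  let ?H = "\<lambda>h. (1 / h) *\<^sub>R (G (t + h) - G t)"
  have "(\<lambda>h. norm (G (t + h) - G t - h *\<^sub>R G') / norm h) \<midarrow>0\<rightarrow> 0"
    using G by (simp add: has_vector_derivative_def has_derivative_at)
  then have "(\<lambda>h. norm (?H h - G')) \<midarrow>0\<rightarrow> 0"
  proof (rule Lim_transform_eventually)
    have "norm (G (t + h) - G t - h *\<^sub>R G') / norm h = norm (?H h - G')" if "h \<noteq> 0" for h
    proof -
      have "?H h - G' = (1 / h) *\<^sub>R (G (t + h) - G t - h *\<^sub>R G')"
        using that by (simp add: scaleR_diff_right)
      then show ?thesis by simp
    qed
    then show "\<forall>\<^sub>F h in at 0. norm (G (t + h) - G t - h *\<^sub>R G') / norm h = norm (?H h - G')"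
      by (auto simp: eventually_at_filter)
  qed
  then have lim: "?H \<midarrow>0\<rightarrow> G'"
    by (simp add: tendsto_norm_zero_iff LIM_zero_iff)
  have H: "?H h \<in> R" "hermitian (?H h)" for h
    by (intro closures hermitian_scaleR hermitian_diff mem)+
  have "G' \<in> R \<inter> {U. hermitian U}"
    by (rule Lim_in_closed_set[OF closed_Int[OF algebra_closed[OF algebra] closed_hermitian] _ _ lim])
      (use H in \<open>auto intro: always_eventually\<close>)
  then have G': "G' \<in> R" "hermitian G'" by auto
  have "(\<lambda>h. tr (?H h)) \<midarrow>0\<rightarrow> tr G'"
    by (rule tendsto_tr[OF lim H G'])
  then show ?thesis
    by (simp add: DERIV_def tr_scaleR tr_diff closures mem)
qed

text \<open>\<open>G'\<close> contains \<open>B\<close> in all positions among the powers of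
  \<open>T = A + tB\<close>; cyclicity gathers them, but only against factors that commute with
  \<open>T\<close>. Quantifying over all \<open>q\<close> makes the induction work: the extra factor
  \<open>T\<close> of the product rule is absorbed by replacing \<open>q\<close> with
  \<open>pCons 0 q\<close>.\<close>

lemma has_vector_derivative_poly_op:
  assumes A: "A \<in> R" and B: "B \<in> R"
  shows "\<exists>G'\<in>R. ((\<lambda>s. poly_op p (A + s *\<^sub>R B)) has_vector_derivative G') (at t) \<and>
    (\<forall>q. tr (poly_op q (A + t *\<^sub>R B) o\<^sub>L G')
       = tr (poly_op q (A + t *\<^sub>R B) o\<^sub>L (poly_op (pderiv p) (A + t *\<^sub>R B) o\<^sub>L B)))"
proof (induction p)
  case 0
  have "((\<lambda>s. poly_op 0 (A + s *\<^sub>R B)) has_vector_derivative 0) (at t)" by simp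
  then show ?case
    using algebra_0[OF algebra] by (intro bexI[of _ 0]) (simp_all add: blinfun_compose.zero_left blinfun_compose.zero_right)
next
  case (pCons a p)
  let ?T = "\<lambda>s. A + s *\<^sub>R B"
  have TR: "poly_op q (?T t) \<in> R" "?T t \<in> R" for q
    by (intro algebra_poly_op[OF algebra] closures A B)+
  from pCons.IH obtain G' where G': "G' \<in> R" "((\<lambda>s. poly_op p (?T s)) has_vector_derivative G') (at t)"
    and eq: "\<And>q. tr (poly_op q (?T t) o\<^sub>L G') = tr (poly_op q (?T t) o\<^sub>L (poly_op (pderiv p) (?T t) o\<^sub>L B))"
    by blast
  let ?G = "(?T t o\<^sub>L G') + (B o\<^sub>L poly_op p (?T t))"
  have "(?T has_vector_derivative B) (at t)"
    by (auto intro!: derivative_eq_intros)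
  then have "((\<lambda>s. ?T s o\<^sub>L poly_op p (?T s)) has_vector_derivative ?G) (at t)"
    by (rule blinfun_compose.has_vector_derivative) (rule G'(2))
  then have 1: "((\<lambda>s. poly_op (pCons a p) (?T s)) has_vector_derivative ?G) (at t)"
    unfolding poly_op_pCons by (rule has_vector_derivative_add[OF has_vector_derivative_const, of _ _ _ "a *\<^sub>R id_blinfun", simplified])
  have 2: "tr (poly_op q (?T t) o\<^sub>L ?G) = tr (poly_op q (?T t) o\<^sub>L (poly_op (pderiv (pCons a p)) (?T t) o\<^sub>L B))" for q
  proof -
    define X where "X = ?T t"
    note TR = TR[folded X_def] and eq = eq[folded X_def]
    let ?q = "poly_op q X" and ?p = "poly_op p X" and ?p' = "poly_op (pderiv p) X"
    have qT: "X o\<^sub>L ?q = ?q o\<^sub>L X"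
      using poly_op_commute[of "[:0, 1:]" "X" q] by (simp add: poly_op_X)
    have "?q o\<^sub>L ((X o\<^sub>L G') + (B o\<^sub>L ?p)) = ((X o\<^sub>L ?q) o\<^sub>L G') + (?q o\<^sub>L (B o\<^sub>L ?p))"
      by (simp only: qT blinfun_compose.add_right blinfun_compose_assoc)
    then have "tr (?q o\<^sub>L ((X o\<^sub>L G') + (B o\<^sub>L ?p))) = tr ((X o\<^sub>L ?q) o\<^sub>L G') + tr (?q o\<^sub>L (B o\<^sub>L ?p))"
      by (simp add: tr_add closures TR B G'(1))
    also have "tr ((X o\<^sub>L ?q) o\<^sub>L G') = tr ((X o\<^sub>L ?q) o\<^sub>L (?p' o\<^sub>L B))"
      using eq[of "pCons 0 q"] by (simp add: poly_op_pCons)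
    also have "tr (?q o\<^sub>L (B o\<^sub>L ?p)) = tr ((?q o\<^sub>L B) o\<^sub>L ?p)"
      by (simp only: blinfun_compose_assoc)
    also have "\<dots> = tr (?p o\<^sub>L (?q o\<^sub>L B))"
      by (intro tr_commute closures TR B)
    also have "?p o\<^sub>L (?q o\<^sub>L B) = ?q o\<^sub>L (?p o\<^sub>L B)"
      by (metis blinfun_compose_assoc poly_op_commute)
    also have "tr ((X o\<^sub>L ?q) o\<^sub>L (?p' o\<^sub>L B)) + tr (?q o\<^sub>L (?p o\<^sub>L B))
        = tr (((X o\<^sub>L ?q) o\<^sub>L (?p' o\<^sub>L B)) + (?q o\<^sub>L (?p o\<^sub>L B)))"
      by (simp add: tr_add closures TR B)
    also have "((X o\<^sub>L ?q) o\<^sub>L (?p' o\<^sub>L B)) + (?q o\<^sub>L (?p o\<^sub>L B)) = ?q o\<^sub>L (poly_op (pderiv (pCons a p)) X o\<^sub>L B)"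
      by (simp only: qT pderiv_pCons poly_op_add poly_op_pCons scaleR_zero_left add_0_left
          blinfun_compose.add_right blinfun_compose.add_left blinfun_compose_assoc add.commute)
    finally show ?thesis by (simp only: X_def)
  qed
  show ?case
    using 1 2 by (intro bexI[of _ ?G]) (blast, intro closures TR B G'(1))
qed

lemma has_real_derivative_tr_poly_op:
  assumes "A \<in> R" "hermitian A" "B \<in> R" "hermitian B"
  shows "((\<lambda>s. tr (poly_op p (A + s *\<^sub>R B))) has_real_derivative
    tr (poly_op (pderiv p) (A + t *\<^sub>R B) o\<^sub>L B)) (at t)"
proof -
  obtain G' where G': "((\<lambda>s. poly_op p (A + s *\<^sub>R B)) has_vector_derivative G') (at t)"
    "tr (poly_op 1 (A + t *\<^sub>R B) o\<^sub>L G') = tr (poly_op 1 (A + t *\<^sub>R B) o\<^sub>L (poly_op (pderiv p) (A + t *\<^sub>R B) o\<^sub>L B))"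
    using has_vector_derivative_poly_op[OF assms(1,3)] by blast
  have "((\<lambda>s. tr (poly_op p (A + s *\<^sub>R B))) has_real_derivative tr G') (at t)"
    by (rule has_real_derivative_tr[OF G'(1)])
      (intro algebra_poly_op[OF algebra] hermitian_poly_op closures hermitian_add hermitian_scaleR assms)+
  then show ?thesis using G'(2) by simp
qed

end

section \<open>Polynomial approximation of inverses, and the sandwiched resolvent\<close>

lemma norm_op_inv_le:
  fixes P :: "'h::complex_hilbert \<Rightarrow>\<^sub>L 'h"
  assumes P: "regular P" and m: "0 < m" "\<And>x. m * (norm x)\<^sup>2 \<le> rin (P x) x"
  shows "norm (op_inv P) \<le> 1 / m"
proof (rule norm_blinfun_bound)
  fix y
  let ?x = "op_inv P y"
  have "m * (norm ?x)\<^sup>2 \<le> rin (P ?x) ?x" by (rule m(2))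
  also have "\<dots> \<le> norm y * norm ?x"
    using rin_le_norm[of y ?x] by (simp add: op_inv_apply P)
  finally have "norm ?x * (m * norm ?x) \<le> norm ?x * norm y"
    by (simp add: power2_eq_square mult_ac)
  then have "m * norm ?x \<le> norm y"
    by (cases "?x = 0") (simp_all add: mult_le_cancel_left)
  then show "norm ?x \<le> 1 / m * norm y" using m(1) by (simp add: field_simps)
qed (use m(1) in simp)

text \<open>The difference factors as \<open>(q(T) T - I) T\<inverse>\<close>. The spectral bound
  handles the polynomial factor, where \<open>\<bar>t q(t) - 1\<bar> \<le> M d\<close>, and the
  other factor has norm at most \<open>1 / m\<close>.\<close>

lemma norm_poly_op_diff_inv_le:
  fixes T :: "'h::complex_hilbert \<Rightarrow>\<^sub>L 'h"
  assumes T: "hermitian T" "0 < m" "\<And>x. m * (norm x)\<^sup>2 \<le> rin (T x) x" "norm T \<le> M" and "m \<le> M"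
    and q: "\<And>x. x \<in> {m..M} \<Longrightarrow> \<bar>poly q x - inverse x\<bar> \<le> d" and "0 \<le> d"
  shows "norm (poly_op q T - op_inv T) \<le> M * d / m"
proof -
  have reg: "regular T"
    by (rule bounded_below_regular(1)[OF norm_closed_algebra_UNIV UNIV_I T(1-3)])
  have "poly_op q T - op_inv T = poly_op (q * [:0, 1:] - 1) T o\<^sub>L op_inv T"
    by (simp only: poly_op_diff poly_op_mult poly_op_X poly_op_1 blinfun_compose.diff_left blinfun_compose_assoc
        op_inv_right[OF reg] blinfun_compose_id)
  also have "norm \<dots> \<le> norm (poly_op (q * [:0, 1:] - 1) T) * norm (op_inv T)"
    by (rule norm_blinfun_compose)
  also have "\<dots> \<le> (M * d) * (1 / m)"
  proof (intro mult_mono norm_op_inv_le reg T norm_poly_op_le)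
    fix t assume "t \<in> real_spectrum T"
    then have t: "t \<in> {m..M}" using real_spectrum_subset[OF T(1,3,4)] by blast
    then have "poly (q * [:0, 1:] - 1) t = t * (poly q t - inverse t)"
      using T(2) by (simp add: algebra_simps)
    then have "\<bar>poly (q * [:0, 1:] - 1) t\<bar> = t * \<bar>poly q t - inverse t\<bar>"
      using t T(2) by (simp add: abs_mult)
    also have "\<dots> \<le> M * d"
      using t T(2) q[OF t] by (intro mult_mono) auto
    finally show "\<bar>poly (q * [:0, 1:] - 1) t\<bar> \<le> M * d" .
  qed (use assms in auto)
  finally show ?thesis by simp
qed

text \<open>This rests on the push-through identity
  \<open>(I + t C A\<inverse> C) C = C A\<inverse> (A + t C\<^sup>2)\<close>.\<close>

lemma op_sqrt_resolvent:
  fixes A B :: "'h::complex_hilbert \<Rightarrow>\<^sub>L 'h"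
  assumes C: "C o\<^sub>L C = B" and A: "regular A" and AB: "regular (A + t *\<^sub>R B)"
    and X: "X = C o\<^sub>L op_inv A o\<^sub>L C" and reg: "regular (id_blinfun + t *\<^sub>R X)"
  shows "C o\<^sub>L op_inv (A + t *\<^sub>R B) o\<^sub>L C = op_inv (id_blinfun + t *\<^sub>R X) o\<^sub>L X"
proof -
  define T where "T = A + t *\<^sub>R B"
  define P where "P = id_blinfun + t *\<^sub>R X"
  have T: "regular T" and P: "regular P" using AB reg by (simp_all add: T_def P_def)
  have "P o\<^sub>L C = (C o\<^sub>L op_inv A) o\<^sub>L T"
    by (rule blinfun_eqI)
      (simp add: P_def T_def X C[symmetric] blinfun.add_left blinfun.add_right blinfun.scaleR_left
        blinfun.scaleR_right op_inv_apply A)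
  then have "P o\<^sub>L (C o\<^sub>L op_inv T o\<^sub>L C) = X"
    by (metis T X blinfun_compose_assoc blinfun_compose_id(1) op_inv_right)
  then have "op_inv P o\<^sub>L X = (op_inv P o\<^sub>L P) o\<^sub>L (C o\<^sub>L op_inv T o\<^sub>L C)"
    by (simp add: blinfun_compose_assoc)
  then show ?thesis by (simp add: op_inv_left P flip: T_def P_def)
qed

lemma regular_id_add_positive:
  fixes X :: "'h::complex_hilbert \<Rightarrow>\<^sub>L 'h"
  assumes X: "positive_op X" and t: "0 \<le> t"
  shows "positive_op (id_blinfun + t *\<^sub>R X)" "regular (id_blinfun + t *\<^sub>R X)"
proof -
  have h: "hermitian (id_blinfun + t *\<^sub>R X)"
    using X by (intro hermitian_add hermitian_id hermitian_scaleR) (simp add: positive_op_iff)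
  have b: "1 * (norm x)\<^sup>2 \<le> rin ((id_blinfun + t *\<^sub>R X) x) x" for x
    using X t by (simp add: blinfun.add_left blinfun.scaleR_left rin_add_left rin_scaleR_left
        positive_op_iff rin_self)
  show "regular (id_blinfun + t *\<^sub>R X)"
    by (rule bounded_below_regular(1)[OF norm_closed_algebra_UNIV UNIV_I h zero_less_one b])
  have "0 \<le> rin ((id_blinfun + t *\<^sub>R X) x) x" for x
    using b[of x] by (meson order_trans zero_le_power2 mult_1 order_refl zero_le_mult_iff zero_le_one)
  then show "positive_op (id_blinfun + t *\<^sub>R X)"
    using h by (simp add: positive_op_iff)
qed

lemma positive_op_sandwich:
  assumes "positive_op T" "hermitian U"
  shows "positive_op (U o\<^sub>L T o\<^sub>L U)"
  using assms hermitianD[OF assms(2)] by (simp add: positive_op_iff hermitian_sandwich)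

lemma algebra_op_inv:
  assumes R: "norm_closed_algebra R" and P: "P \<in> R" "positive_op P" "regular P"
  shows "op_inv P \<in> R"
proof -
  obtain m where "0 < m" "\<And>x. m * (norm x)\<^sup>2 \<le> rin (P x) x"
    using positive_regular_bounded_below P by (metis positive_op_iff)
  then show ?thesis
    using bounded_below_regular(2)[OF R P(1)] P(2) by (simp add: positive_op_iff)
qed

context faithful_trace
begin

text \<open>The derivative passes through the limit of \<open>tr (p n (A + sB))\<close> because the
  derivatives converge uniformly in \<open>s\<close>. The bounds \<open>m\<close> and
  \<open>M\<close> hold for all \<open>s\<close> in \<open>[0, 1]\<close>, so one sequence of
  polynomials serves the whole path; at the endpoints the derivative is one-sided.\<close>

lemma has_real_derivative_tr_log:
  assumes A: "A \<in> R" "hermitian A" and m: "0 < m" "\<And>x. m * (norm x)\<^sup>2 \<le> rin (A x) x"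
    and B: "B \<in> R" "positive_op B" and t: "t \<in> {0..1}"
  shows "((\<lambda>s. tr (op_log (A + s *\<^sub>R B))) has_real_derivative tr (op_inv (A + t *\<^sub>R B) o\<^sub>L B)) (at t within {0..1})"
proof -
  have hB: "hermitian B" using B(2) by (simp add: positive_op_iff)
  define T where "T s = A + s *\<^sub>R B" for s
  \<comment> \<open>The norms bound every \<open>T s\<close> with \<open>s\<close> in
    \<open>[0, 1]\<close>; the summand \<open>m\<close> ensures \<open>m \<le> M\<close>.\<close>
  define M where "M = norm A + norm B + m"
  have M: "m \<le> M" "0 < M" using m(1) by (simp_all add: M_def add_nonneg_pos)
  have TR: "T s \<in> R" "hermitian (T s)" for s
    unfolding T_def by (intro closures A B hermitian_add hermitian_scaleR hB)+
  have Tm: "m * (norm x)\<^sup>2 \<le> rin (T s x) x" if "s \<in> {0..1}" for s x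
    using m(2)[of x] B(2) that
    by (simp add: T_def blinfun.add_left blinfun.scaleR_left rin_add_left rin_scaleR_left positive_op_iff add_increasing2)
  have TM: "norm (T s) \<le> M" if "s \<in> {0..1}" for s
  proof -
    have "norm (T s) \<le> norm A + \<bar>s\<bar> * norm B"
      unfolding T_def using norm_triangle_ineq[of A "s *\<^sub>R B"] by simp
    also have "\<dots> \<le> norm A + 1 * norm B"
      using that by (intro add_left_mono mult_right_mono) auto
    finally show ?thesis using m(1) by (simp add: M_def)
  qed
  have reg: "regular (T s)" "op_inv (T s) \<in> R" "hermitian (op_inv (T s))" if "s \<in> {0..1}" for s
    using bounded_below_regular[OF algebra TR m(1) Tm[OF that]] hermitian_op_inv[OF TR(2)] by auto
  have spec: "real_spectrum (T s) \<subseteq> {m..M}" if "s \<in> {0..1}" for s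
    by (rule real_spectrum_subset[OF TR(2) Tm[OF that] TM[OF that]])
  obtain p where p: "uniform_limit {m..M} (\<lambda>n. poly (p n)) ln sequentially"
    and p': "uniform_limit {m..M} (\<lambda>n. poly (pderiv (p n))) inverse sequentially"
    using ln_poly_approx[OF m(1) M(1)] by blast
  have lim: "(\<lambda>n. tr (poly_op (p n) (T s))) \<longlonglongrightarrow> tr (op_log (T s))" if "s \<in> {0..1}" for s
  proof -
    have cont: "continuous_on {m..M} ln" using m(1) by (intro continuous_intros) auto
    have "(\<lambda>n. poly_op (p n) (T s)) \<longlonglongrightarrow> op_log (T s)"
      unfolding op_log_def by (rule cfc_tendsto[OF TR(2) uniform_limit_on_subset[OF p spec[OF that]]])
    then show ?thesis
      by (rule tendsto_tr)
        (auto simp: op_log_def intro: algebra_poly_op[OF algebra] TR hermitian_poly_op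
          algebra_cfc[OF algebra TR spec[OF that] cont] hermitian_cfc[OF TR(2) spec[OF that] cont])
  qed
  have "\<exists>g. \<forall>s\<in>{0..1}. (\<lambda>n. tr (poly_op (p n) (T s))) \<longlonglongrightarrow> g s \<and>
      (g has_derivative (*) (tr (op_inv (T s) o\<^sub>L B))) (at s within {0..1})"
  proof (rule has_derivative_sequence[OF convex_real_interval(5) _ _ _ lim])
    fix n s
    show "((\<lambda>s. tr (poly_op (p n) (T s))) has_derivative (*) (tr (poly_op (pderiv (p n)) (T s) o\<^sub>L B))) (at s within {0..1})"
      using has_real_derivative_tr_poly_op[OF A B(1) hB, of "p n" s]
      unfolding T_def has_field_derivative_def by (rule has_derivative_at_withinI)
  next
    fix e :: real assume "0 < e"
    \<comment> \<open>This solves \<open>M * d / m * norm B \<le> e\<close>, with \<open>1\<close>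
      added so that \<open>B = 0\<close> is allowed.\<close>
    define d where "d = e * m / (M * (norm B + 1))"
    have d: "0 < d" using \<open>0 < e\<close> m(1) M(2) by (simp add: d_def add_nonneg_pos)
    have de: "M * d / m * norm B \<le> e"
    proof -
      have "M * d / m * norm B = e * (norm B / (norm B + 1))"
        using m(1) M(2) by (simp add: d_def)
      also have "\<dots> \<le> e * 1"
        using \<open>0 < e\<close> by (intro mult_left_mono) (simp_all add: divide_le_eq add_nonneg_pos)
      finally show ?thesis by simp
    qed
    show "\<forall>\<^sub>F n in sequentially. \<forall>s\<in>{0..1}. \<forall>h.
        norm (tr (poly_op (pderiv (p n)) (T s) o\<^sub>L B) * h - tr (op_inv (T s) o\<^sub>L B) * h) \<le> e * norm h"
      using uniform_limitD[OF p' d]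
    proof eventually_elim
      case (elim n)
      show ?case
      proof (intro ballI allI)
        fix s h :: real assume s: "s \<in> {0..1}"
        let ?q = "poly_op (pderiv (p n)) (T s)"
        have q: "?q \<in> R" "hermitian ?q"
          by (intro algebra_poly_op[OF algebra] hermitian_poly_op TR)+
        have "tr (?q o\<^sub>L B) - tr (op_inv (T s) o\<^sub>L B) = tr ((?q - op_inv (T s)) o\<^sub>L B)"
          by (simp add: blinfun_compose.diff_left tr_diff closures q reg[OF s] B)
        also have "\<bar>\<dots>\<bar> \<le> norm (?q - op_inv (T s)) * norm B"
          by (intro tr_abs_compose_le closures hermitian_diff q reg[OF s] B hB)
        also have "\<dots> \<le> M * d / m * norm B"
        proof (intro mult_right_mono norm_poly_op_diff_inv_le TR m(1) Tm s TM M)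
          fix x assume "x \<in> {m..M}"
          then show "\<bar>poly (pderiv (p n)) x - inverse x\<bar> \<le> d"
            using bspec[OF elim] by (simp add: dist_real_def less_imp_le)
        qed (use d in simp_all)
        finally have "\<bar>tr (?q o\<^sub>L B) - tr (op_inv (T s) o\<^sub>L B)\<bar> * \<bar>h\<bar> \<le> e * \<bar>h\<bar>"
          using de by (intro mult_right_mono) simp_all
        then show "norm (tr (?q o\<^sub>L B) * h - tr (op_inv (T s) o\<^sub>L B) * h) \<le> e * norm h"
          by (simp flip: left_diff_distrib abs_mult)
      qed
    qed
  qed (use t in auto)
  then obtain g where g: "\<And>s. s \<in> {0..1} \<Longrightarrow> (\<lambda>n. tr (poly_op (p n) (T s))) \<longlonglongrightarrow> g s"
    and g': "\<And>s. s \<in> {0..1} \<Longrightarrow> (g has_derivative (*) (tr (op_inv (T s) o\<^sub>L B))) (at s within {0..1})"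
    by blast
  have "g s = tr (op_log (T s))" if "s \<in> {0..1}" for s
    using LIMSEQ_unique[OF g[OF that] lim[OF that]] .
  then have "((\<lambda>s. tr (op_log (T s))) has_derivative (*) (tr (op_inv (T t) o\<^sub>L B))) (at t within {0..1})"
    by (rule has_derivative_transform_within[OF g'[OF t] zero_less_one t])
  then show ?thesis by (simp add: T_def has_field_derivative_def)
qed

text \<open>With \<open>C = B\<^sup>1\<^sup>/\<^sup>2\<close> and \<open>X = C A\<inverse> C\<close>, the derivative depends on \<open>A\<close> only through \<open>X\<close>.\<close>

lemma has_real_derivative_tr_log_sandwich:
  assumes A: "A \<in> R" "positive_op A" "regular A" and B: "B \<in> R" "positive_op B"
    and X: "X = op_sqrt B o\<^sub>L op_inv A o\<^sub>L op_sqrt B" and t: "t \<in> {0..1}"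
  shows "((\<lambda>s. tr (op_log (A + s *\<^sub>R B))) has_real_derivative tr (op_inv (id_blinfun + t *\<^sub>R X) o\<^sub>L X)) (at t within {0..1})"
proof -
  let ?C = "op_sqrt B" and ?T = "A + t *\<^sub>R B"
  obtain m where m: "0 < m" "\<And>x. m * (norm x)\<^sup>2 \<le> rin (A x) x"
    using positive_regular_bounded_below A by (metis positive_op_iff)
  have hA: "hermitian A" using A by (simp add: positive_op_iff)
  have C: "?C \<in> R" "hermitian ?C" by (intro algebra_op_sqrt hermitian_op_sqrt B algebra)+
  have "positive_op X"
    unfolding X by (intro positive_op_sandwich positive_op_inv A C)
  have "hermitian ?T" "m * (norm x)\<^sup>2 \<le> rin (?T x) x" for x
    using m(2)[of x] B(2) t hA
    by (simp_all add: hermitian_add hermitian_scaleR blinfun.add_left blinfun.scaleR_left rin_add_left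
        rin_scaleR_left positive_op_iff add_increasing2)
  then have T: "regular ?T" "op_inv ?T \<in> R"
    using bounded_below_regular[OF algebra _ _ m(1), of ?T] A B by (simp_all add: closures)
  have P: "regular (id_blinfun + t *\<^sub>R X)"
    using regular_id_add_positive(2)[OF \<open>positive_op X\<close>] t by simp
  have "tr (op_inv ?T o\<^sub>L B) = tr ((op_inv ?T o\<^sub>L ?C) o\<^sub>L ?C)"
    by (simp add: blinfun_compose_assoc op_sqrt_square[OF B(2)])
  also have "\<dots> = tr (?C o\<^sub>L (op_inv ?T o\<^sub>L ?C))"
    by (intro tr_commute closures T C)
  also have "?C o\<^sub>L (op_inv ?T o\<^sub>L ?C) = op_inv (id_blinfun + t *\<^sub>R X) o\<^sub>L X"
    using op_sqrt_resolvent[OF op_sqrt_square[OF B(2)] A(3) T(1) X P] by (simp only: blinfun_compose_assoc)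
  finally show ?thesis
    using has_real_derivative_tr_log[OF A(1) hA m B t] by simp
qed

text \<open>Expand \<open>(P\<inverse> - Q\<inverse>) P (P\<inverse> - Q\<inverse>) \<ge> 0\<close>.\<close>

lemma tr_inv_le:
  assumes P: "P \<in> R" "positive_op P" "regular P" and Q: "Q \<in> R" "positive_op Q" "regular Q"
    and eq: "tr (op_inv Q o\<^sub>L P o\<^sub>L op_inv Q) = tr (op_inv Q)"
  shows "tr (op_inv Q) \<le> tr (op_inv P)" and "tr (op_inv P) = tr (op_inv Q) \<Longrightarrow> P = Q"
proof -
  let ?p = "op_inv P" and ?q = "op_inv Q"
  let ?W = "(?p - ?q) o\<^sub>L P o\<^sub>L (?p - ?q)"
  have inR: "?p \<in> R" "?q \<in> R" by (intro algebra_op_inv algebra P Q)+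
  have h: "hermitian (?p - ?q)"
    using P Q by (intro hermitian_diff hermitian_op_inv) (simp_all add: positive_op_iff)
  have W: "?W \<in> R" "positive_op ?W"
    by (intro closures inR P positive_op_sandwich h)+
  have "?W = (?p - (2 *\<^sub>R ?q)) + (?q o\<^sub>L P o\<^sub>L ?q)"
    by (rule blinfun_eqI)
      (simp add: blinfun.diff_left blinfun.diff_right blinfun.add_left blinfun.scaleR_left op_inv_apply P(3) scaleR_2)
  then have tr: "tr ?W = tr ?p - tr ?q"
    by (simp add: tr_add tr_diff tr_scaleR closures inR P eq)
  then show "tr ?q \<le> tr ?p" using tr_nonneg[OF W] by simp
  assume "tr ?p = tr ?q"
  then have "?W = 0" using tr_faithful[OF W] tr by simp
  \<comment> \<open>\<open>?W = 0\<close> says that the form of \<open>P\<close> vanishes on the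
    range of \<open>?p - ?q\<close>; the strict lower bound of \<open>P\<close> then makes that
    range zero.\<close>
  obtain m where m: "0 < m" "\<And>x. m * (norm x)\<^sup>2 \<le> rin (P x) x"
    using positive_regular_bounded_below P by (metis positive_op_iff)
  have "(?p - ?q) x = 0" for x
  proof -
    have "m * (norm ((?p - ?q) x))\<^sup>2 \<le> rin (P ((?p - ?q) x)) ((?p - ?q) x)" by (rule m(2))
    also have "\<dots> = rin (?W x) x" using hermitianD[OF h] by simp
    also have "\<dots> = 0" using \<open>?W = 0\<close> by (simp add: rin.zero_left)
    finally show ?thesis using m(1) by (simp add: mult_le_0_iff)
  qed
  then have "?p - ?q = 0" by (intro blinfun_eqI) simp
  then have "op_inv ?p = op_inv ?q" by simp
  then show "P = Q" by (simp add: op_inv_op_inv P Q)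
qed

end

section \<open>Conditional expectations\<close>

lemma scale_op_of_real: "scale_op (complex_of_real r) T = r *\<^sub>R T"
  by (rule blinfun_eqI) (simp add: scale_op_apply scaleR_scaleC blinfun.scaleR_left)

text \<open>The strong operator topology is weaker than the norm topology, so strongly closed sets
  are norm closed.\<close>

lemma von_neumann_norm_closed_algebra:
  fixes R :: "('h::complex_hilbert \<Rightarrow>\<^sub>L 'h) set"
  assumes "von_neumann_algebra R"
  shows "norm_closed_algebra R"
proof -
  have "closedin strong_operator_topology R"
    using assms by (simp add: von_neumann_algebra_def)
  from closedin_continuous_map_preimage[OF strong_operator_topology_weaker_than_euclidean this]
  have "closed R" by simp
  moreover have "\<forall>r. \<forall>T\<in>R. r *\<^sub>R T \<in> R"
    using assms by (simp add: von_neumann_algebra_def flip: scale_op_of_real)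
  ultimately show ?thesis
    using assms by (simp add: von_neumann_algebra_def norm_closed_algebra_def)
qed

lemma tracial_state_faithful_trace:
  assumes R: "von_neumann_algebra R" and tau: "tracial_state R \<tau>" "faithful_on R \<tau>"
  shows "faithful_trace R (\<lambda>T. Re (\<tau> T))"
proof
  show "norm_closed_algebra R" by (rule von_neumann_norm_closed_algebra[OF R])
  fix T assume T: "T \<in> R"
  show "Re (\<tau> (r *\<^sub>R T)) = r * Re (\<tau> T)" for r
    using tau(1) T by (simp add: tracial_state_def flip: scale_op_of_real)
  show "0 \<le> Re (\<tau> T)" if "positive_op T"
    using tau(1) T that by (simp add: tracial_state_def complex_nonneg_Reals_iff)
  show "T = 0" if "positive_op T" "Re (\<tau> T) = 0"
  proof -
    \<comment> \<open>Only the real part is known to vanish; positivity makes the trace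
      real.\<close>
    have "\<tau> T \<in> \<real>\<^sub>\<ge>\<^sub>0" using tau(1) T that(1) by (simp add: tracial_state_def)
    then have "\<tau> T = 0" using that(2) by (simp add: complex_nonneg_Reals_iff complex_eq_iff)
    then show ?thesis using tau(2) T that(1) by (simp add: faithful_on_def)
  qed
qed (use tau(1) in \<open>simp_all add: tracial_state_def\<close>)

lemma fk_det_ratio:
  assumes "positive_op A" "positive_op B"
  shows "fk_det \<tau> (A + B) / fk_det \<tau> A = exp (Re (\<tau> (op_log (A + B))) - Re (\<tau> (op_log A)))"
proof -
  have "positive_op (A + B)"
    using assms by (simp add: positive_op_iff hermitian_add blinfun.add_left rin_add_left)
  then show ?thesis using assms by (simp add: fk_det_positive exp_diff)
qed

lemma conditional_expectation_add:
    "conditional_expectation R S \<Phi> \<Longrightarrow> T \<in> R \<Longrightarrow> U \<in> R \<Longrightarrow> \<Phi> (T + U) = \<Phi> T + \<Phi> U"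
  and conditional_expectation_scaleR:
    "conditional_expectation R S \<Phi> \<Longrightarrow> T \<in> R \<Longrightarrow> \<Phi> (r *\<^sub>R T) = r *\<^sub>R \<Phi> T"
  and conditional_expectation_id: "conditional_expectation R S \<Phi> \<Longrightarrow> \<Phi> id_blinfun = id_blinfun"
  by (simp_all add: conditional_expectation_def flip: scale_op_of_real)

text \<open>The bimodule property is applied to \<open>T = T I I\<close>, with unitality of
  \<open>\<Phi>\<close>.\<close>

lemma conditional_expectation_ident:
  assumes S: "norm_closed_algebra S" "S \<subseteq> R" and Phi: "conditional_expectation R S \<Phi>" and T: "T \<in> S"
  shows "\<Phi> T = T"
proof -
  have "id_blinfun \<in> S" by (rule algebra_id[OF S(1)])
  then have "\<Phi> (T o\<^sub>L id_blinfun o\<^sub>L id_blinfun) = T o\<^sub>L \<Phi> id_blinfun o\<^sub>L id_blinfun"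
    using Phi S T unfolding conditional_expectation_def by blast
  then show ?thesis using Phi by (simp add: conditional_expectation_def)
qed

context faithful_trace
begin

lemma tr_resolvent:
  assumes X: "X \<in> R" "positive_op X" and t: "0 \<le> t"
  shows "t * tr (op_inv (id_blinfun + t *\<^sub>R X) o\<^sub>L X) = 1 - tr (op_inv (id_blinfun + t *\<^sub>R X))"
proof -
  let ?P = "id_blinfun + t *\<^sub>R X"
  note reg = regular_id_add_positive[OF X(2) t]
  have P: "op_inv ?P \<in> R"
    by (intro algebra_op_inv algebra reg closures X)
  have "t *\<^sub>R (op_inv ?P o\<^sub>L X) = op_inv ?P o\<^sub>L (?P - id_blinfun)"
    by (simp add: blinfun_compose.scaleR_right)
  also have "\<dots> = id_blinfun - op_inv ?P"
    by (simp only: blinfun_compose.diff_right op_inv_left[OF reg(2)] blinfun_compose_id)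
  finally have "tr (t *\<^sub>R (op_inv ?P o\<^sub>L X)) = tr (id_blinfun - op_inv ?P)" by simp
  then show ?thesis
    by (simp add: tr_scaleR tr_diff tr_id closures P X)
qed

lemma tr_resolvent_expectation_le:
  assumes S: "norm_closed_algebra S" "S \<subseteq> R" and Phi: "conditional_expectation R S \<Phi>"
    and pres: "\<And>T. T \<in> R \<Longrightarrow> tr (\<Phi> T) = tr T"
    and X: "X \<in> R" "positive_op X" and t: "0 < t"
  shows "tr (op_inv (id_blinfun + t *\<^sub>R X) o\<^sub>L X) \<le> tr (op_inv (id_blinfun + t *\<^sub>R \<Phi> X) o\<^sub>L \<Phi> X)"
    and "tr (op_inv (id_blinfun + t *\<^sub>R X) o\<^sub>L X) = tr (op_inv (id_blinfun + t *\<^sub>R \<Phi> X) o\<^sub>L \<Phi> X) \<Longrightarrow> X = \<Phi> X"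
proof -
  let ?P = "id_blinfun + t *\<^sub>R X" and ?Q = "id_blinfun + t *\<^sub>R \<Phi> X"
  have Y: "\<Phi> X \<in> S" "positive_op (\<Phi> X)"
    using Phi X by (auto simp: conditional_expectation_def)
  have YR: "\<Phi> X \<in> R" using Y(1) S(2) by blast
  have P: "?P \<in> R" "positive_op ?P" "regular ?P"
    using regular_id_add_positive[OF X(2), of t] t by (simp_all add: closures X)
  have QS: "?Q \<in> S"
    using Y(1) by (intro algebra_add[OF S(1)] algebra_id[OF S(1)] algebra_scaleR[OF S(1)])
  have Q: "?Q \<in> R" "positive_op ?Q" "regular ?Q"
    using regular_id_add_positive[OF Y(2), of t] t by (simp_all add: closures YR)
  have iQ: "op_inv ?Q \<in> S" by (rule algebra_op_inv[OF S(1) QS Q(2,3)])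
  have PQ: "\<Phi> ?P = ?Q"
    by (simp add: conditional_expectation_add[OF Phi] conditional_expectation_scaleR[OF Phi]
        conditional_expectation_id[OF Phi] closures X)
  have "tr (op_inv ?Q o\<^sub>L ?P o\<^sub>L op_inv ?Q) = tr (\<Phi> (op_inv ?Q o\<^sub>L ?P o\<^sub>L op_inv ?Q))"
    by (intro pres[symmetric] closures P) (use iQ S(2) in auto)
  \<comment> \<open>Since \<open>op_inv ?Q\<close> lies in \<open>S\<close>, both outer factors can
    be pulled out of \<open>\<Phi>\<close>, which then turns \<open>?P\<close> into
    \<open>?Q\<close>.\<close>
  also have "\<Phi> (op_inv ?Q o\<^sub>L ?P o\<^sub>L op_inv ?Q) = op_inv ?Q o\<^sub>L ?Q o\<^sub>L op_inv ?Q"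
    using Phi P(1) iQ PQ by (simp add: conditional_expectation_def)
  also have "\<dots> = op_inv ?Q" by (simp only: op_inv_left[OF Q(3)] blinfun_compose_id)
  finally have eq: "tr (op_inv ?Q o\<^sub>L ?P o\<^sub>L op_inv ?Q) = tr (op_inv ?Q)" .
  note le = tr_inv_le[OF P Q eq]
  note r = tr_resolvent[OF X less_imp_le[OF t]] tr_resolvent[OF YR Y(2) less_imp_le[OF t]]
  have "t * tr (op_inv ?P o\<^sub>L X) \<le> t * tr (op_inv ?Q o\<^sub>L \<Phi> X)"
    using le(1) by (simp only: r)
  then show "tr (op_inv ?P o\<^sub>L X) \<le> tr (op_inv ?Q o\<^sub>L \<Phi> X)" using t by simp
  assume "tr (op_inv ?P o\<^sub>L X) = tr (op_inv ?Q o\<^sub>L \<Phi> X)"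
  then have "tr (op_inv ?P) = tr (op_inv ?Q)" using r by simp
  then have "?P = ?Q" by (rule le(2))
  then show "X = \<Phi> X" using t by simp
qed

end

lemma sandwich_sqrt_mem_iff:
  assumes S: "norm_closed_algebra S" and A: "positive_op A" "regular A"
    and B: "B \<in> S" "positive_op B" "regular B"
  shows "op_sqrt B o\<^sub>L op_inv A o\<^sub>L op_sqrt B \<in> S \<longleftrightarrow> A \<in> S"
proof
  let ?C = "op_sqrt B"
  have C: "?C \<in> S" by (rule algebra_op_sqrt[OF B(2) S B(1)])
  have CC: "?C o\<^sub>L ?C = B" by (rule op_sqrt_square[OF B(2)])
  have reg: "regular ?C" using regular_commute_factor[of ?C ?C] B(3) CC by simp
  \<comment> \<open>Membership of the inverse is read off from
    \<open>C\<inverse> = C B\<inverse>\<close>: \<open>algebra_op_inv\<close> asks for positivity,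
    whereas for \<open>C\<close> only hermiticity has been established.\<close>
  have "op_inv ?C = op_inv ?C o\<^sub>L ((?C o\<^sub>L ?C) o\<^sub>L op_inv B)"
    by (simp only: CC op_inv_right[OF B(3)] blinfun_compose_id)
  also have "\<dots> = (op_inv ?C o\<^sub>L ?C) o\<^sub>L (?C o\<^sub>L op_inv B)"
    by (simp only: blinfun_compose_assoc)
  also have "\<dots> = ?C o\<^sub>L op_inv B"
    by (simp only: op_inv_left[OF reg] blinfun_compose_id)
  finally have iC: "op_inv ?C \<in> S"
    using algebra_compose[OF S C algebra_op_inv[OF S B]] by simp
  assume "?C o\<^sub>L op_inv A o\<^sub>L ?C \<in> S"
  note algebra_compose[OF S algebra_compose[OF S iC this] iC]
  also have "op_inv ?C o\<^sub>L (?C o\<^sub>L op_inv A o\<^sub>L ?C) o\<^sub>L op_inv ?C = op_inv A"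
    by (rule blinfun_eqI) (simp add: op_inv_apply reg)
  finally have "op_inv A \<in> S" .
  then have "op_inv (op_inv A) \<in> S"
    by (rule algebra_op_inv[OF S _ positive_op_inv[OF A] regular_op_inv[OF A(2)]])
  then show "A \<in> S" by (simp add: op_inv_op_inv A)
next
  assume "A \<in> S"
  then show "op_sqrt B o\<^sub>L op_inv A o\<^sub>L op_sqrt B \<in> S"
    by (intro algebra_compose[OF S] algebra_op_inv[OF S] algebra_op_sqrt[OF _ S] A B)
qed

theorem corollary4p3:
  fixes R S :: "('h::complex_hilbert \<Rightarrow>\<^sub>L 'h) set"
    and \<tau> :: "('h \<Rightarrow>\<^sub>L 'h) \<Rightarrow> complex"
    and \<Phi> :: "('h \<Rightarrow>\<^sub>L 'h) \<Rightarrow> ('h \<Rightarrow>\<^sub>L 'h)"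
    and A B :: "'h \<Rightarrow>\<^sub>L 'h"
  assumes separable: "separable_space (euclidean :: 'h topology)"
    and R: "finite_von_neumann_algebra R"
    and tau: "tracial_state R \<tau>" "faithful_on R \<tau>" "normal_on R \<tau>"
    and S: "von_neumann_algebra S" "S \<subseteq> R"
    and Phi: "conditional_expectation R S \<Phi>" "\<Phi> ` R = S" "trace_preserving R \<tau> \<Phi>"
    and A: "A \<in> R" "positive_op A" "regular A"
    and B: "B \<in> S" "positive_op B"
  shows "fk_det \<tau> (A + B) / fk_det \<tau> A
           \<le> fk_det \<tau> (op_inv (\<Phi> (op_inv A)) + B) / fk_det \<tau> (op_inv (\<Phi> (op_inv A)))
       \<and> (fk_det \<tau> (A + B) / fk_det \<tau> A
            = fk_det \<tau> (op_inv (\<Phi> (op_inv A)) + B) / fk_det \<tau> (op_inv (\<Phi> (op_inv A)))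
          \<longleftrightarrow> op_sqrt B o\<^sub>L op_inv A o\<^sub>L op_sqrt B \<in> S)
       \<and> (regular B \<longrightarrow>
            (fk_det \<tau> (A + B) / fk_det \<tau> A
               = fk_det \<tau> (op_inv (\<Phi> (op_inv A)) + B) / fk_det \<tau> (op_inv (\<Phi> (op_inv A)))
             \<longleftrightarrow> A \<in> S))"
proof -
  interpret faithful_trace R "\<lambda>T. Re (\<tau> T)"
    using R tau by (intro tracial_state_faithful_trace) (simp add: finite_von_neumann_algebra_def)
  have algS: "norm_closed_algebra S" by (rule von_neumann_norm_closed_algebra[OF S(1)])
  have pres: "Re (\<tau> (\<Phi> T)) = Re (\<tau> T)" if "T \<in> R" for T
    using Phi(3) that by (simp add: trace_preserving_def)
  define G where "G = \<Phi> (op_inv A)"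
  have iA: "op_inv A \<in> R" "positive_op (op_inv A)" "regular (op_inv A)"
    by (intro algebra_op_inv algebra positive_op_inv regular_op_inv A)+
  obtain m where m: "0 < m" "\<And>x. m * (norm x)\<^sup>2 \<le> rin (op_inv A x) x"
    using positive_regular_bounded_below iA by (metis positive_op_iff)
  have G: "G \<in> S" "positive_op G"
    using Phi(1) iA by (auto simp: G_def conditional_expectation_def)
  \<comment> \<open>\<open>\<Phi>\<close> is positive and unital, so the lower bound
    \<open>m\<close> of \<open>A\<inverse>\<close> passes to \<open>G\<close>: the positive operator
    \<open>A\<inverse> - m I\<close> is mapped to \<open>G - m I\<close>.\<close>
  have "regular G"
  proof (rule bounded_below_regular(1)[OF norm_closed_algebra_UNIV UNIV_I _ m(1)])
    show "hermitian G" using G(2) by (simp add: positive_op_iff)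
    let ?D = "op_inv A + (- m) *\<^sub>R id_blinfun"
    have D: "rin (?D x) x = rin (op_inv A x) x - m * (norm x)\<^sup>2" for x
      by (simp add: blinfun.add_left blinfun.diff_left blinfun.scaleR_left rin.diff_left rin_scaleR_left rin_self)
    have "hermitian ?D"
      using iA(2) by (intro hermitian_add hermitian_scaleR hermitian_id) (simp add: positive_op_iff)
    then have "positive_op ?D"
      using m(2) by (simp add: positive_op_iff D del: scaleR_minus_left)
    moreover have "\<Phi> ?D = G + (- m) *\<^sub>R id_blinfun"
      by (simp only: G_def conditional_expectation_add[OF Phi(1)] conditional_expectation_scaleR[OF Phi(1)]
          conditional_expectation_id[OF Phi(1)] closures iA)
    ultimately have "positive_op (G + (- m) *\<^sub>R id_blinfun)"
      using Phi(1) iA(1) unfolding conditional_expectation_def by (metis closures(1,2,4))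
    then show "m * (norm x)\<^sup>2 \<le> rin (G x) x" for x
      by (simp add: positive_op_iff blinfun.diff_left blinfun.scaleR_left rin.diff_left rin_scaleR_left rin_self)
  qed
  define A' where "A' = op_inv G"
  have A': "A' \<in> S" "positive_op A'" "regular A'" "op_inv A' = G"
    unfolding A'_def
    by (intro algebra_op_inv[OF algS] positive_op_inv regular_op_inv op_inv_op_inv G \<open>regular G\<close>)+
  define C where "C = op_sqrt B"
  have C: "C \<in> S" "hermitian C"
    unfolding C_def by (intro algebra_op_sqrt hermitian_op_sqrt B algS)+
  define X where "X = C o\<^sub>L op_inv A o\<^sub>L C"
  have X: "X \<in> R" "positive_op X"
    unfolding X_def using C S(2) iA by (auto intro!: closures positive_op_sandwich)
  \<comment> \<open>As \<open>C\<close> lies in \<open>S\<close>, \<open>\<Phi>\<close> acts only on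
    the middle factor; hence \<open>\<Phi> X\<close> is the sandwiched operator belonging to
    \<open>A'\<close>.\<close>
  have PX: "\<Phi> X = C o\<^sub>L op_inv A' o\<^sub>L C"
    unfolding X_def A'(4) G_def using Phi(1) C iA(1) by (simp add: conditional_expectation_def)
  have BR: "B \<in> R" "A' \<in> R" using B(1) A'(1) S(2) by auto
  define F H where "F s = Re (\<tau> (op_log (A + s *\<^sub>R B)))" and "H s = Re (\<tau> (op_log (A' + s *\<^sub>R B)))" for s
  define u v where "u s = Re (\<tau> (op_inv (id_blinfun + s *\<^sub>R X) o\<^sub>L X))"
    and "v s = Re (\<tau> (op_inv (id_blinfun + s *\<^sub>R \<Phi> X) o\<^sub>L \<Phi> X))" for s
  have "((\<lambda>s. H s - F s) has_derivative (\<lambda>h. (v s - u s) * h)) (at s within {0..1})" if "0 \<le> s" "s \<le> 1" for s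
    using DERIV_diff[OF has_real_derivative_tr_log_sandwich[OF BR(2) A'(2,3) BR(1) B(2) PX[unfolded C_def], of s]
        has_real_derivative_tr_log_sandwich[OF A BR(1) B(2) X_def[unfolded C_def], of s]] that
    unfolding F_def H_def u_def v_def has_field_derivative_def by simp
  \<comment> \<open>The intermediate point is strictly positive, as the comparison of
    \<open>u\<close> and \<open>v\<close> requires. The difference of the two increments equals
    \<open>v s - u s\<close> there, so this one point decides both the inequality and its equality
    case.\<close>
  then obtain s where s: "0 < s" and mvt: "(H 1 - F 1) - (H 0 - F 0) = v s - u s"
    using mvt_simple[of 0 1 "\<lambda>s. H s - F s" "\<lambda>s h. (v s - u s) * h"] by auto
  note cmp = tr_resolvent_expectation_le[OF algS S(2) Phi(1) pres X s, folded u_def v_def]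
  have "F 1 - F 0 \<le> H 1 - H 0" using cmp(1) mvt by simp
  moreover have "F 1 - F 0 = H 1 - H 0 \<longleftrightarrow> X \<in> S"
  proof
    assume "F 1 - F 0 = H 1 - H 0"
    then have "X = \<Phi> X" using cmp(2) mvt by simp
    moreover have "\<Phi> X \<in> S" using Phi(1) X(1) by (auto simp: conditional_expectation_def)
    ultimately show "X \<in> S" by simp
  next
    assume "X \<in> S"
    then have "\<Phi> X = X" by (rule conditional_expectation_ident[OF algS S(2) Phi(1)])
    then show "F 1 - F 0 = H 1 - H 0" using mvt by (simp add: u_def v_def)
  qed
  moreover have "fk_det \<tau> (A + B) / fk_det \<tau> A = exp (F 1 - F 0)"
    by (simp add: fk_det_ratio A B F_def)
  moreover have "fk_det \<tau> (A' + B) / fk_det \<tau> A' = exp (H 1 - H 0)"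
    by (simp add: fk_det_ratio A' B H_def)
  moreover have "X \<in> S \<longleftrightarrow> A \<in> S" if "regular B"
    unfolding X_def C_def by (rule sandwich_sqrt_mem_iff[OF algS A(2,3) B that])
  ultimately show ?thesis
    unfolding A'_def G_def X_def C_def by simp
qed

end
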